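(* Assume that the coefficients of the channel satisfy $\sum_{\ell=1}^{\infty}\alpha_\ell<\infty$ and that the process $\{U_k\}$ is independent and identically distributed (IID). Then $$\sup_{\mathrm{SNR}>0}\frac{C_{\mathrm{Info}}(\mathrm{SNR})}{\mathrm{SNR}}\;\ge\;\sup_{\mathrm{SNR}>0}\frac{C_{\alpha=0}(\mathrm{SNR})}{\mathrm{SNR}},$$ where $C_{\mathrm{Info}}(\mathrm{SNR})$ is the information capacity (without feedback) of the channel $$Y_k=x_k+\sqrt{\sigma^2+\sum_{\ell=1}^{k-1}\alpha_{k-\ell}x_\ell^2}\;\cdot U_k,\qquad k\ge 1,$$ and $C_{\alpha=0}(\mathrm{SNR})$ is the capacity (without feedback) of the channel $Y_k=x_k+\sigma\cdot U_k$, $k\ge 1$ (the special case in which all $\alpha_\ell$ are zero).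
   Context: Notation: $A_m^n$ stands for $A_m,\dots,A_n$; $\log$ is the natural logarithm; $I$ is mutual information and $h$ differential entropy (in nats). Channel model. Fix $\sigma^2>0$ and real coefficients $\alpha_\ell$, $\ell\in\{1,2,\dots\}$, with $\alpha_\ell\ge 0$ and $\sup_{\ell\ge1}\alpha_\ell<\infty$. Let $\{U_k\}_{k\in\mathbb{Z}}$ be a real-valued, zero-mean, unit-variance, stationary, weakly-mixing random process with $\mathsf{E}[U_k^4]<\infty$ and finite differential entropy rate, $h(U_k\mid U_{-\infty}^{k-1})>-\infty$. Conditional on inputs $X_1=x_1,\dots,X_k=x_k\in\mathbb{R}$, the time-$k$ channel output is $$Y_k=x_k+\sqrt{\sigma^2+\sum_{\ell=1}^{k-1}\alpha_{k-\ell}x_\ell^2}\;\cdot U_k,\qquad k=1,2,\dots$$ The process $\{U_k\}$ is independent of the message $M$ (and hence, without feedback, of the inputs). Power constraint. For $\mathsf{P}>0$ the inputs must satisfy $\frac1n\sum_{k=1}^n\mathsf{E}[X_k^2]\le\mathsf{P}$. With $\sigma^2$ fixed, $\mathrm{SNR}=\mathsf{P}/\sigma^2$. Information capacity without feedback: $C_{\mathrm{Info}}(\mathrm{SNR})=\liminf_{n\to\infty}\frac1n\sup I(X_1^n;Y_1^n)$, where the supremum is over all joint distributions of $(X_1,\dots,X_n)$ (independent of $\{U_k\}$) satisfying the power constraint. Capacity without feedback: a code of block-length $n$ consists of a finite message set $\mathcal{M}_n$, an encoder $\phi_n:\mathcal{M}_n\to\mathbb{R}^n$, $X_1^n=\phi_n(M)$,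 and a decoder $\psi_n:\mathbb{R}^n\to\mathcal{M}_n$, $\hat M=\psi_n(Y_1^n)$, where $M$ is uniform on $\mathcal{M}_n$ and the power constraint holds (expectation over $M$). Its rate is $\frac1n\log|\mathcal{M}_n|$ (nats per channel use). A rate $R$ is achievable if there is a sequence of such codes with rates at least $R$ asymptotically (i.e. $\liminf_n \frac1n\log|\mathcal{M}_n|\ge R$) and $\Pr(\hat M\ne M)\to0$ as $n\to\infty$. The capacity is the supremum of all achievable rates. *)

theory Defs
  imports "HOL-Probability.Probability"
begin

subsection \<open>Two-sided real-valued processes\<close>

definition stationary_process :: "'a measure \<Rightarrow> (int \<Rightarrow> 'a \<Rightarrow> real) \<Rightarrow> bool" where
  "stationary_process M U \<longleftrightarrow>
     distr M (PiM UNIV (\<lambda>_. borel)) (\<lambda>\<omega> j. U (j + 1) \<omega>) =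
     distr M (PiM UNIV (\<lambda>_. borel)) (\<lambda>\<omega> j. U j \<omega>)"

text \<open>Weak mixing of the shift on path space under the law of the process.\<close>

definition weakly_mixing_process :: "'a measure \<Rightarrow> (int \<Rightarrow> 'a \<Rightarrow> real) \<Rightarrow> bool" where
  "weakly_mixing_process M U \<longleftrightarrow>
     (\<forall>A \<in> sets (PiM UNIV (\<lambda>_. borel)). \<forall>B \<in> sets (PiM UNIV (\<lambda>_. borel)).
        (\<lambda>n. (\<Sum>k<n. \<bar>\<P>(\<omega> in M. (\<lambda>j. U j \<omega>) \<in> A \<and> (\<lambda>j. U (j + int k) \<omega>) \<in> B)
                      - \<P>(\<omega> in M. (\<lambda>j. U j \<omega>) \<in> A) * \<P>(\<omega> in M. (\<lambda>j. U j \<omega>) \<in> B)\<bar>) / real n)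
          \<longlonglongrightarrow> 0)"

text \<open>
  Conditional differential entropy \<open>h(X | Z)\<close> in nats, for real \<open>X\<close> and arbitrary \<open>Z\<close> with values
  in \<open>T\<close>. Let \<open>f(x, z)\<close> be the density of the law of \<open>(X, Z)\<close> with respect to Lebesgue measure times
  the law of \<open>Z\<close>, i.e. the conditional density of \<open>X\<close> given \<open>Z = z\<close>. Then \<open>h(X | Z)\<close> is the
  expectation of \<open>- ln f(X, Z)\<close>, split below into its positive and negative parts
  (\<open>ennreal\<close> maps negative reals to 0), and it is \<open>-\<infinity>\<close> if there is no such density.
  The difference is well defined when the first term is finite, in particular if \<open>X\<close> has finite
  variance.
\<close>

definition cond_diff_entropy ::
    "'a measure \<Rightarrow> 'b measure \<Rightarrow> ('a \<Rightarrow> real) \<Rightarrow> ('a \<Rightarrow> 'b) \<Rightarrow> ereal" where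
  "cond_diff_entropy M T X Z =
     (let Q = lborel \<Otimes>\<^sub>M distr M T Z;
          J = distr M (borel \<Otimes>\<^sub>M T) (\<lambda>\<omega>. (X \<omega>, Z \<omega>))
      in if absolutely_continuous Q J
         then enn2ereal (\<integral>\<^sup>+ p. ennreal (- entropy_density (exp 1) Q J p) \<partial>J)
              - enn2ereal (\<integral>\<^sup>+ p. ennreal (entropy_density (exp 1) Q J p) \<partial>J)
         else - \<infinity>)"

text \<open>\<open>h(U\<^sub>k | U\<^sub>k\<^sub>-\<^sub>1, U\<^sub>k\<^sub>-\<^sub>2, \<dots>)\<close>\<close>

definition diff_entropy_given_past :: "'a measure \<Rightarrow> (int \<Rightarrow> 'a \<Rightarrow> real) \<Rightarrow> int \<Rightarrow> ereal" where
  "diff_entropy_given_past M U k =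
     cond_diff_entropy M (PiM {..k - 1} (\<lambda>_. borel)) (U k) (\<lambda>\<omega>. \<lambda>j\<in>{..k - 1}. U j \<omega>)"


subsection \<open>The channel\<close>

text \<open>\<open>\<sigma>\<close> is the standard deviation; the value \<open>\<alpha> 0\<close> is never used.\<close>

definition channel_output ::
    "real \<Rightarrow> (nat \<Rightarrow> real) \<Rightarrow> (nat \<Rightarrow> real) \<Rightarrow> (nat \<Rightarrow> real) \<Rightarrow> nat \<Rightarrow> real" where
  "channel_output \<sigma> \<alpha> x u k = x k + sqrt (\<sigma>\<^sup>2 + (\<Sum>l\<in>{1..<k}. \<alpha> (k - l) * (x l)\<^sup>2)) * u k"

definition output_block ::
    "real \<Rightarrow> (nat \<Rightarrow> real) \<Rightarrow> (int \<Rightarrow> 'a \<Rightarrow> real) \<Rightarrow> nat \<Rightarrow> (nat \<Rightarrow> real) \<Rightarrow> 'a \<Rightarrow> (nat \<Rightarrow> real)" where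
  "output_block \<sigma> \<alpha> U n x \<omega> = (\<lambda>k\<in>{1..n}. channel_output \<sigma> \<alpha> x (\<lambda>i. U (int i) \<omega>) k)"

abbreviation block_space :: "nat \<Rightarrow> (nat \<Rightarrow> real) measure" where
  "block_space n \<equiv> PiM {1..n} (\<lambda>_. borel)"


subsection \<open>Information capacity\<close>

definition input_laws :: "nat \<Rightarrow> real \<Rightarrow> (nat \<Rightarrow> real) measure set" where
  "input_laws n P = {\<mu>. prob_space \<mu> \<and> sets \<mu> = sets (block_space n) \<and>
     (\<Sum>k=1..n. \<integral>\<^sup>+ x. ennreal ((x k)\<^sup>2) \<partial>\<mu>) / of_nat n \<le> ennreal P}"

text \<open>
  Mutual information between channel input and output when the input has law \<open>\<mu>\<close>; taking the product
  measure makes the input independent of the noise. The library's real-valued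
  \<open>mutual_information\<close> agrees with the usual notion here: a power constraint on \<open>\<mu>\<close> together with
  finite variance and finite differential entropy of the noise makes the joint law absolutely
  continuous with respect to the product of the marginals, with finite divergence.
\<close>

definition io_information ::
    "real \<Rightarrow> (nat \<Rightarrow> real) \<Rightarrow> 'a measure \<Rightarrow> (int \<Rightarrow> 'a \<Rightarrow> real) \<Rightarrow> nat \<Rightarrow> (nat \<Rightarrow> real) measure \<Rightarrow> real" where
  "io_information \<sigma> \<alpha> M U n \<mu> =
     prob_space.mutual_information (\<mu> \<Otimes>\<^sub>M M) (exp 1) (block_space n) (block_space n)
       fst (\<lambda>(x, \<omega>). output_block \<sigma> \<alpha> U n x \<omega>)"

text \<open>Capacities are functions of the SNR; the power is \<open>P = SNR * \<sigma>\<^sup>2\<close>.\<close>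

definition info_capacity ::
    "real \<Rightarrow> (nat \<Rightarrow> real) \<Rightarrow> 'a measure \<Rightarrow> (int \<Rightarrow> 'a \<Rightarrow> real) \<Rightarrow> real \<Rightarrow> ereal" where
  "info_capacity \<sigma> \<alpha> M U snr =
     liminf (\<lambda>n. (SUP \<mu>\<in>input_laws n (snr * \<sigma>\<^sup>2). ereal (io_information \<sigma> \<alpha> M U n \<mu>)) / ereal (real n))"


subsection \<open>Operational capacity\<close>

text \<open>
  A code consists of a finite message set (without loss of generality of natural numbers), an encoder
  and a measurable decoder. The message is uniform on the message set.
\<close>

definition is_code ::
    "nat \<Rightarrow> real \<Rightarrow> nat set \<Rightarrow> (nat \<Rightarrow> nat \<Rightarrow> real) \<Rightarrow> ((nat \<Rightarrow> real) \<Rightarrow> nat) \<Rightarrow> bool" where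
  "is_code n P W \<phi> \<psi> \<longleftrightarrow>
     finite W \<and> W \<noteq> {} \<and>
     \<phi> \<in> W \<rightarrow> space (block_space n) \<and>
     \<psi> \<in> measurable (block_space n) (count_space W) \<and>
     (\<Sum>k=1..n. \<integral>m. (\<phi> m k)\<^sup>2 \<partial>uniform_count_measure W) / real n \<le> P"

definition error_prob ::
    "real \<Rightarrow> (nat \<Rightarrow> real) \<Rightarrow> 'a measure \<Rightarrow> (int \<Rightarrow> 'a \<Rightarrow> real) \<Rightarrow> nat \<Rightarrow>
     nat set \<Rightarrow> (nat \<Rightarrow> nat \<Rightarrow> real) \<Rightarrow> ((nat \<Rightarrow> real) \<Rightarrow> nat) \<Rightarrow> real" where
  "error_prob \<sigma> \<alpha> M U n W \<phi> \<psi> =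
     \<P>(p in uniform_count_measure W \<Otimes>\<^sub>M M.
        \<psi> (output_block \<sigma> \<alpha> U n (\<phi> (fst p)) (snd p)) \<noteq> fst p)"

definition achievable ::
    "real \<Rightarrow> (nat \<Rightarrow> real) \<Rightarrow> 'a measure \<Rightarrow> (int \<Rightarrow> 'a \<Rightarrow> real) \<Rightarrow> real \<Rightarrow> real \<Rightarrow> bool" where
  "achievable \<sigma> \<alpha> M U P R \<longleftrightarrow>
     (\<exists>W \<phi> \<psi>. (\<forall>n\<ge>1. is_code n P (W n) (\<phi> n) (\<psi> n)) \<and>
        ereal R \<le> liminf (\<lambda>n. ereal (ln (real (card (W n))) / real n)) \<and>
        (\<lambda>n. error_prob \<sigma> \<alpha> M U n (W n) (\<phi> n) (\<psi> n)) \<longlonglongrightarrow> 0)"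

definition capacity ::
    "real \<Rightarrow> (nat \<Rightarrow> real) \<Rightarrow> 'a measure \<Rightarrow> (int \<Rightarrow> 'a \<Rightarrow> real) \<Rightarrow> real \<Rightarrow> ereal" where
  "capacity \<sigma> \<alpha> M U snr = (SUP R\<in>{R. achievable \<sigma> \<alpha> M U (snr * \<sigma>\<^sup>2) R}. ereal R)"

end

theory Submission
  imports Defs
begin

text \<open>
  Both sides are compared with the relative entropy per unit cost
  \<open>\<sigma>\<^sup>2 D(x + \<sigma>U \<parallel> \<sigma>U) / x\<^sup>2\<close>, written variationally as the supremum of
  \<open>\<sigma>\<^sup>2 (E g(x + \<sigma>U) - E e\<^bsup>g(\<sigma>U)\<^esup> + 1) / x\<^sup>2\<close> over bounded continuous \<open>g\<close>.

  For the heating channel the inputs are IID, equal to \<open>x\<close> with probability \<open>\<delta>\<close> and to \<open>0\<close>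
  otherwise. The expected heat at any time is at most \<open>\<delta> x\<^sup>2 \<Sum>\<alpha>\<close>, so as \<open>\<delta> \<rightarrow> 0\<close> it disappears
  relative to the signal. A mismatched-decoding bound, with the score computed as if there
  were no heat, shows that the information per channel use is at least \<open>\<delta>\<close> times the variational
  expression minus \<open>o(\<delta>)\<close>.

  For the memoryless channel, relative entropy to the output law of the zero codeword adds up over
  the coordinates of a codeword. Testing it with a multiple of the indicator of the decoding region
  and averaging over the messages bounds the code size.
\<close>

subsection \<open>Variational relative entropy\<close>

text \<open>The predicate \<open>measurable_on\<close> supplies continuous functions that converge
  to \<open>g\<close> off a negligible set. Clamping them to the interval from \<open>- B\<close> to
  \<open>B\<close> keeps continuity and the limit, and provides the bound for dominated
  convergence.\<close>

lemma borel_measurable_continuous_approx: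
  fixes g :: "real \<Rightarrow> real"
  assumes g: "g \<in> borel_measurable borel" and B: "\<And>y. \<bar>g y\<bar> \<le> B"
  obtains f where "\<And>n. continuous_on UNIV (f n)" "\<And>n y. \<bar>f n y\<bar> \<le> B"
    "AE y in lborel. (\<lambda>n. f n y) \<longlonglongrightarrow> g y"
proof -
  have "g measurable_on UNIV"
    using g by (intro lebesgue_measurable_imp_measurable_on) (auto simp: measurable_completion)
  then obtain N f where N: "negligible N" and f: "\<And>n. continuous_on UNIV (f n)"
    and lim: "\<And>y. y \<notin> N \<Longrightarrow> (\<lambda>n. f n y) \<longlonglongrightarrow> g y"
    unfolding measurable_on_def by auto
  have B0: "0 \<le> B" using B[of 0] by simp
  define c where "c = (\<lambda>n y. max (- B) (min B (f n y)))"
  show thesis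
  proof
    show "continuous_on UNIV (c n)" for n
      unfolding c_def by (intro continuous_intros f)
    show "\<bar>c n y\<bar> \<le> B" for n y using B0 by (auto simp: c_def)
    have "(\<lambda>n. c n y) \<longlonglongrightarrow> g y" if "y \<notin> N" for y
    proof -
      have "(\<lambda>n. c n y) \<longlonglongrightarrow> max (- B) (min B (g y))"
        unfolding c_def by (intro tendsto_intros lim that)
      moreover have "max (- B) (min B (g y)) = g y" using B[of y] by auto
      ultimately show ?thesis by simp
    qed
    moreover have "AE y in lebesgue. y \<notin> N"
      using N by (simp add: negligible_iff_null_sets AE_not_in)
    ultimately have "AE y in lebesgue. (\<lambda>n. c n y) \<longlonglongrightarrow> g y" by auto
    then show "AE y in lborel. (\<lambda>n. c n y) \<longlonglongrightarrow> g y"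
      by (simp add: AE_completion_iff)
  qed
qed

text \<open>
  By the Donsker--Varadhan formula this says that the relative entropy of \<open>P\<close> with respect to
  \<open>Q\<close> is at most \<open>D\<close>.
\<close>

definition relative_entropy_le :: "'b measure \<Rightarrow> 'b measure \<Rightarrow> real \<Rightarrow> bool" where
  "relative_entropy_le P Q D \<longleftrightarrow>
     (\<forall>g\<in>borel_measurable Q. (\<exists>B. \<forall>y. \<bar>g y\<bar> \<le> B) \<longrightarrow> (\<integral>y. g y \<partial>P) \<le> D + ln (\<integral>y. exp (g y) \<partial>Q))"

lemma relative_entropy_leD:
  assumes "relative_entropy_le P Q D" "g \<in> borel_measurable Q" "\<And>y. \<bar>g y\<bar> \<le> B"
  shows "(\<integral>y. g y \<partial>P) \<le> D + ln (\<integral>y. exp (g y) \<partial>Q)"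
  using assms unfolding relative_entropy_le_def by blast

lemma (in prob_space) integrable_bounded:
  fixes f :: "'a \<Rightarrow> real"
  assumes "f \<in> borel_measurable M" "\<And>x. \<bar>f x\<bar> \<le> B"
  shows "integrable M f"
  using assms by (intro integrable_const_bound[of _ B]) auto

lemma (in prob_space) expectation_exp_bounds:
  fixes g :: "'a \<Rightarrow> real"
  assumes [measurable]: "g \<in> borel_measurable M" and B: "\<And>x. \<bar>g x\<bar> \<le> B"
  shows "integrable M (\<lambda>x. exp (g x))" "exp (- B) \<le> (\<integral>x. exp (g x) \<partial>M)" "(\<integral>x. exp (g x) \<partial>M) \<le> exp B"
proof -
  have b: "- B \<le> g x" "g x \<le> B" for x using B[of x] by auto
  show i: "integrable M (\<lambda>x. exp (g x))"
    using b by (intro integrable_bounded[of _ "exp B"]) auto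
  show "exp (- B) \<le> (\<integral>x. exp (g x) \<partial>M)" "(\<integral>x. exp (g x) \<partial>M) \<le> exp B"
    using i b by (auto intro!: integral_ge_const integral_le_const)
qed

text \<open>Induction on the index set. Integrating out the new coordinate turns a test function
  \<open>g\<close> into the logarithm of its partial exponential moment, which is the test function
  for the remaining coordinates. Fubini then reassembles the full exponential moment.\<close>

lemma relative_entropy_le_PiM:
  assumes "finite I"
    and P: "\<And>i. prob_space (P i)" and Q: "\<And>i. prob_space (Q i)"
    and sets: "\<And>i. sets (P i) = sets (Q i)"
    and D: "\<And>i. i \<in> I \<Longrightarrow> relative_entropy_le (P i) (Q i) (D i)"
  shows "relative_entropy_le (PiM I P) (PiM I Q) (\<Sum>i\<in>I. D i)"
  using \<open>finite I\<close> D
proof (induction I rule: finite_induct)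
  case empty
  then show ?case
    by (auto simp: relative_entropy_le_def PiM_empty lebesgue_integral_count_space_finite)
next
  case (insert i I)
  interpret P: product_prob_space P by (intro product_prob_spaceI P)
  interpret Q: product_prob_space Q by (intro product_prob_spaceI Q)
  interpret PI: prob_space "PiM I P" by (intro prob_space_PiM P)
  interpret QI: prob_space "PiM I Q" by (intro prob_space_PiM Q)
  interpret PI': prob_space "PiM (insert i I) P" by (intro prob_space_PiM P)
  interpret QI': prob_space "PiM (insert i I) Q" by (intro prob_space_PiM Q)
  have [measurable_cong]: "sets (P j) = sets (Q j)" for j by (rule sets)
  have sPQ [measurable_cong]: "sets (PiM J P) = sets (PiM J Q)" for J
    by (intro sets_PiM_cong sets) auto
  show ?case
    unfolding relative_entropy_le_def
  proof (intro ballI impI)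
    fix g :: "_ \<Rightarrow> real"
    assume g [measurable]: "g \<in> borel_measurable (PiM (insert i I) Q)" and "\<exists>B. \<forall>y. \<bar>g y\<bar> \<le> B"
    then obtain B where B: "\<And>y. \<bar>g y\<bar> \<le> B" by blast
    define e where "e x = (\<integral>y. exp (g (x(i := y))) \<partial>Q i)" for x
    have gi [measurable]: "(\<lambda>y. g (x(i := y))) \<in> borel_measurable (Q i)" if "x \<in> space (PiM I Q)" for x
      using that by (measurable; auto)
    have [measurable]: "(\<lambda>(x, y). g (x(i := y))) \<in> borel_measurable (PiM I Q \<Otimes>\<^sub>M Q i)"
      by measurable
    have e_meas [measurable]: "e \<in> borel_measurable (PiM I Q)"
      unfolding e_def by measurable
    have sp: "space (PiM I P) = space (PiM I Q)" by (rule sets_eq_imp_space_eq[OF sPQ])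
    have eb: "exp (- B) \<le> e x" "e x \<le> exp B" if "x \<in> space (PiM I Q)" for x
      unfolding e_def using Q.M.expectation_exp_bounds[OF gi[OF that], of B] B by auto
    \<comment> \<open>A test function has to be bounded everywhere, whereas \<open>e\<close> is
      controlled only on the space of the product. The clamp changes nothing on that space.\<close>
    define c where "c x = max (- B) (min B (ln (e x)))" for x
    have c_meas [measurable]: "c \<in> borel_measurable (PiM I Q)" unfolding c_def by measurable
    have "0 \<le> B" using B[of undefined] by simp
    have cb: "\<bar>c x\<bar> \<le> B" for x using \<open>0 \<le> B\<close> by (auto simp: c_def)
    have c: "c x = ln (e x)" if "x \<in> space (PiM I Q)" for x
    proof -
      have "0 < e x" using eb(1)[OF that] exp_gt_zero[of "- B"] by linarith
      then have "- B \<le> ln (e x)" "ln (e x) \<le> B" using eb[OF that] by (auto simp: ln_ge_iff ln_le_cancel_iff[of _ "exp B", simplified])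
      then show ?thesis by (auto simp: c_def)
    qed
    have c': "exp (c x) = e x" if "x \<in> space (PiM I Q)" for x
      using c[OF that] less_le_trans[OF exp_gt_zero eb(1)[OF that]] by simp
    have gP: "integrable (PiM (insert i I) P) g"
      using B by (intro PI'.integrable_bounded[of _ B]) auto
    have gQ: "integrable (PiM (insert i I) Q) (\<lambda>y. exp (g y))"
      using B by (intro QI'.expectation_exp_bounds[of _ B]) auto
    have "(\<integral>y. g y \<partial>PiM (insert i I) P) = (\<integral>x. (\<integral>y. g (x(i := y)) \<partial>P i) \<partial>PiM I P)"
      by (rule P.product_integral_insert[OF insert.hyps gP])
    also have "\<dots> \<le> (\<integral>x. D i + c x \<partial>PiM I P)"
    proof (rule integral_mono)
      show "integrable (PiM I P) (\<lambda>x. \<integral>y. g (x(i := y)) \<partial>P i)"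
      proof (rule PI.integrable_const_bound[of _ B])
        show "AE x in PiM I P. norm (\<integral>y. g (x(i := y)) \<partial>P i) \<le> B"
        proof (intro AE_I2)
          fix x assume "x \<in> space (PiM I P)"
          then have gi': "(\<lambda>y. g (x(i := y))) \<in> borel_measurable (P i)"
            using gi[of x] sp by (simp add: measurable_cong_sets[OF sets refl])
          have "integrable (P i) (\<lambda>y. g (x(i := y)))"
            using B by (intro P.M.integrable_bounded[OF gi', of B]) auto
          then show "norm (\<integral>y. g (x(i := y)) \<partial>P i) \<le> B"
            using B by (auto simp: abs_le_iff minus_le_iff intro!: P.M.integral_le_const P.M.integral_ge_const)
        qed
      qed measurable
      show "integrable (PiM I P) (\<lambda>x. D i + c x)"
        using cb by (intro Bochner_Integration.integrable_add PI.integrable_bounded[of c B]) auto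
      fix x assume "x \<in> space (PiM I P)"
      then have x: "x \<in> space (PiM I Q)" using sp by simp
      show "(\<integral>y. g (x(i := y)) \<partial>P i) \<le> D i + c x"
        using relative_entropy_leD[OF insert.prems[of i] gi[OF x], of B] B c[OF x]
        by (simp add: e_def)
    qed
    also have "\<dots> = D i + (\<integral>x. c x \<partial>PiM I P)"
      using cb PI.prob_space
      by (subst Bochner_Integration.integral_add) (auto intro!: PI.integrable_bounded[of c B])
    also have "(\<integral>x. c x \<partial>PiM I P) \<le> (\<Sum>i\<in>I. D i) + ln (\<integral>x. exp (c x) \<partial>PiM I Q)"
      using insert by (intro relative_entropy_leD[OF _ c_meas cb]) auto
    also have "(\<integral>x. exp (c x) \<partial>PiM I Q) = (\<integral>x. e x \<partial>PiM I Q)"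
      using c' by (intro Bochner_Integration.integral_cong) auto
    also have "\<dots> = (\<integral>y. exp (g y) \<partial>PiM (insert i I) Q)"
      unfolding e_def by (rule Q.product_integral_insert[OF insert.hyps gQ, symmetric])
    finally show "(\<integral>y. g y \<partial>PiM (insert i I) P) \<le> (\<Sum>i\<in>insert i I. D i) + ln (\<integral>y. exp (g y) \<partial>PiM (insert i I) Q)"
      using insert.hyps by simp
  qed
qed

text \<open>Continuous test functions suffice because both laws ignore the Lebesgue-null set on
  which the continuous approximation of a measurable function fails. The passage from the linear to
  the logarithmic form is a normalization.\<close>

lemma relative_entropy_le_lborelI:
  assumes P: "prob_space P" "sets P = sets borel" "absolutely_continuous lborel P"
    and Q: "prob_space Q" "sets Q = sets borel" "absolutely_continuous lborel Q"
    and D: "\<And>g B. continuous_on UNIV g \<Longrightarrow> (\<And>y::real. \<bar>g y\<bar> \<le> B) \<Longrightarrow>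
              (\<integral>y. g y \<partial>P) - (\<integral>y. exp (g y) \<partial>Q) + 1 \<le> D"
  shows "relative_entropy_le P Q D"
  unfolding relative_entropy_le_def
proof (intro ballI impI)
  interpret P: prob_space P by fact
  interpret Q: prob_space Q by fact
  note [measurable_cong] = P(2) Q(2)
  fix g :: "real \<Rightarrow> real"
  assume g: "g \<in> borel_measurable Q" and "\<exists>B. \<forall>y. \<bar>g y\<bar> \<le> B"
  then obtain B where B: "\<And>y. \<bar>g y\<bar> \<le> B" by blast
  from g have [measurable]: "g \<in> borel_measurable borel"
    by (simp add: measurable_cong_sets[OF Q(2) refl])
  have key: "(\<integral>y. h y \<partial>P) - (\<integral>y. exp (h y) \<partial>Q) + 1 \<le> D"
    if h [measurable]: "h \<in> borel_measurable borel" and C: "\<And>y. \<bar>h y\<bar> \<le> C" for h C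
  proof -
    obtain f where f: "\<And>n. continuous_on UNIV (f n)" "\<And>n y. \<bar>f n y\<bar> \<le> C"
      and lim: "AE y in lborel. (\<lambda>n. f n y) \<longlonglongrightarrow> h y"
      using borel_measurable_continuous_approx[OF h C] by blast
    have [measurable]: "f n \<in> borel_measurable borel" for n
      by (rule borel_measurable_continuous_onI[OF f(1)])
    have limP: "AE y in P. (\<lambda>n. f n y) \<longlonglongrightarrow> h y"
      using P(3) lim by (rule absolutely_continuous_AE[rotated]) (simp add: P(2))
    have limQ: "AE y in Q. (\<lambda>n. f n y) \<longlonglongrightarrow> h y"
      using Q(3) lim by (rule absolutely_continuous_AE[rotated]) (simp add: Q(2))
    have "(\<lambda>n. \<integral>y. f n y \<partial>P) \<longlonglongrightarrow> (\<integral>y. h y \<partial>P)"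
      using limP f(2) by (intro integral_dominated_convergence[where w = "\<lambda>_. C"]) auto
    moreover have "(\<lambda>n. \<integral>y. exp (f n y) \<partial>Q) \<longlonglongrightarrow> (\<integral>y. exp (h y) \<partial>Q)"
    proof (intro integral_dominated_convergence[where w = "\<lambda>_. exp C"])
      show "AE y in Q. (\<lambda>n. exp (f n y)) \<longlonglongrightarrow> exp (h y)"
        using limQ by eventually_elim (intro tendsto_intros)
      show "AE y in Q. norm (exp (f n y)) \<le> exp C" for n
        using f(2)[of n] by (auto simp: abs_le_iff)
    qed auto
    ultimately have "(\<lambda>n. (\<integral>y. f n y \<partial>P) - (\<integral>y. exp (f n y) \<partial>Q) + 1)
        \<longlonglongrightarrow> (\<integral>y. h y \<partial>P) - (\<integral>y. exp (h y) \<partial>Q) + 1"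
      by (intro tendsto_intros)
    then show ?thesis
      by (rule LIMSEQ_le_const2) (use D[OF f(1) f(2)] in auto)
  qed
  \<comment> \<open>Subtracting the constant \<open>ln e\<close> from \<open>g\<close> makes its
    exponential moment equal to 1. The linear bound for the shifted function is then the logarithmic
    bound for \<open>g\<close>.\<close>
  define e where "e = (\<integral>y. exp (g y) \<partial>Q)"
  have e: "exp (- B) \<le> e" "integrable Q (\<lambda>y. exp (g y))"
    unfolding e_def using Q.expectation_exp_bounds[OF g B] by auto
  then have "0 < e" using exp_gt_zero[of "- B"] by linarith
  have "(\<integral>y. g y - ln e \<partial>P) - (\<integral>y. exp (g y - ln e) \<partial>Q) + 1 \<le> D"
  proof (rule key)
    show "\<bar>g y - ln e\<bar> \<le> B + \<bar>ln e\<bar>" for y using B[of y] by linarith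
  qed measurable
  moreover have "(\<integral>y. g y - ln e \<partial>P) = (\<integral>y. g y \<partial>P) - ln e"
    using P.integrable_bounded[of g B] B P.prob_space by (subst Bochner_Integration.integral_diff) auto
  moreover have "(\<integral>y. exp (g y - ln e) \<partial>Q) = 1"
    using \<open>0 < e\<close> by (simp add: exp_diff e_def)
  ultimately show "(\<integral>y. g y \<partial>P) \<le> D + ln (\<integral>y. exp (g y) \<partial>Q)"
    by (simp add: e_def)
qed

section \<open>Absolute continuity of the noise law\<close>

lemma absolutely_continuous_affine:
  fixes X :: "'a \<Rightarrow> real"
  assumes [measurable]: "X \<in> borel_measurable M" and "s \<noteq> 0"
    and ac: "absolutely_continuous lborel (distr M borel X)"
  shows "absolutely_continuous lborel (distr M borel (\<lambda>\<omega>. a + s * X \<omega>))"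
  unfolding absolutely_continuous_def
proof
  fix N :: "real set" assume N: "N \<in> null_sets lborel"
  then have [measurable]: "N \<in> sets borel" by auto
  define N' where "N' = (\<lambda>u. a + s * u) -` N"
  have N'_meas [measurable]: "N' \<in> sets borel"
    unfolding N'_def by (rule measurable_sets_borel[of _ borel]) measurable
  \<comment> \<open>Affine change of variables: Lebesgue measure is scaled by a nonzero factor, so
    the preimage of a null set is null.\<close>
  have "emeasure lborel N = ennreal \<bar>s\<bar> * emeasure lborel N'"
    unfolding N'_def using \<open>s \<noteq> 0\<close>
    by (subst lborel_real_affine[of s a])
       (auto simp: emeasure_density nn_integral_cmult emeasure_distr)
  then have "N' \<in> null_sets lborel" using N \<open>s \<noteq> 0\<close> by (auto intro!: null_setsI)
  then have "N' \<in> null_sets (distr M borel X)" using ac by (auto simp: absolutely_continuous_def)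
  moreover have "emeasure (distr M borel (\<lambda>\<omega>. a + s * X \<omega>)) N = emeasure (distr M borel X) N'"
    by (simp add: emeasure_distr N'_def vimage_def)
  ultimately show "N \<in> null_sets (distr M borel (\<lambda>\<omega>. a + s * X \<omega>))"
    by (intro null_setsI) auto
qed

text \<open>\<open>cond_diff_entropy\<close> is minus infinity unless the joint law of
  \<open>U k\<close> and its past is absolutely continuous with respect to Lebesgue measure times
  the law of the past. Evaluating this on cylinders over Lebesgue-null sets gives the claim for the
  marginal.\<close>

lemma law_absolutely_continuous:
  fixes U :: "int \<Rightarrow> 'a \<Rightarrow> real"
  assumes "prob_space M"
    and U [measurable]: "\<And>k. U k \<in> borel_measurable M"
    and h: "diff_entropy_given_past M U k > - \<infinity>"
  shows "absolutely_continuous lborel (distr M borel (U k))"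
  unfolding absolutely_continuous_def
proof
  interpret prob_space M by fact
  let ?T = "PiM {..k - 1} (\<lambda>_. borel :: real measure)"
  let ?Z = "\<lambda>\<omega>. \<lambda>j\<in>{..k - 1}. U j \<omega>"
  have Z [measurable]: "?Z \<in> measurable M ?T" by measurable
  interpret D: prob_space "distr M ?T ?Z" by (rule prob_space_distr) fact
  let ?J = "distr M (borel \<Otimes>\<^sub>M ?T) (\<lambda>\<omega>. (U k \<omega>, ?Z \<omega>))"
  have ac: "absolutely_continuous (lborel \<Otimes>\<^sub>M distr M ?T ?Z) ?J"
    using h unfolding diff_entropy_given_past_def cond_diff_entropy_def Let_def
    by (auto split: if_splits)
  fix N assume N: "N \<in> null_sets (lborel :: real measure)"
  then have [measurable]: "N \<in> sets borel" by auto
  have "N \<times> space ?T \<in> null_sets (lborel \<Otimes>\<^sub>M distr M ?T ?Z)"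
  proof (rule null_setsI)
    show "emeasure (lborel \<Otimes>\<^sub>M distr M ?T ?Z) (N \<times> space ?T) = 0"
      using N by (subst D.emeasure_pair_measure_Times) auto
  qed auto
  then have "N \<times> space ?T \<in> null_sets ?J"
    using ac unfolding absolutely_continuous_def by auto
  then have "emeasure ?J (N \<times> space ?T) = 0" by auto
  moreover have "emeasure ?J (N \<times> space ?T) = emeasure M (U k -` N \<inter> space M)"
    using measurable_space[OF Z] by (subst emeasure_distr) (auto intro!: arg_cong[where f = "emeasure M"])
  ultimately show "N \<in> null_sets (distr M borel (U k))"
    by (intro null_setsI) (auto simp: emeasure_distr)
qed

subsection \<open>Converse for the memoryless channel\<close>

lemma measurable_output_block [measurable]:
  assumes [measurable]: "\<And>k. U k \<in> borel_measurable M"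
  shows "output_block \<sigma> \<alpha> U n x \<in> measurable M (block_space n)"
  unfolding output_block_def channel_output_def by measurable

text \<open>Serves to pass from noise indexed by integers to the natural-number times of a block.
  Events are transported along the injection by \<open>inv_into\<close>.\<close>

lemma (in prob_space) indep_vars_reindex:
  assumes "inj_on f I" and indep: "indep_vars N X (f ` I)"
  shows "indep_vars (\<lambda>i. N (f i)) (\<lambda>i. X (f i)) I"
proof -
  have "indep_sets (\<lambda>i. {X (f i) -` A \<inter> space M |A. A \<in> sets (N (f i))}) I"
    unfolding indep_sets_def
  proof (intro conjI ballI allI impI)
    fix J A assume J: "J \<subseteq> I" "J \<noteq> {}" "finite J"
      and A: "A \<in> (\<Pi> j\<in>J. {X (f j) -` A \<inter> space M |A. A \<in> sets (N (f j))})"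
    have inj: "inj_on f J" using assms(1) J(1) by (rule inj_on_subset)
    have "prob (\<Inter>j\<in>f ` J. A (inv_into J f j)) = (\<Prod>j\<in>f ` J. prob (A (inv_into J f j)))"
    proof (rule indep_setsD)
      show "indep_sets (\<lambda>i. {X i -` A \<inter> space M |A. A \<in> sets (N i)}) (f ` I)"
        using indep by (simp add: indep_vars_def2)
      show "\<forall>j\<in>f ` J. A (inv_into J f j) \<in> {X j -` A \<inter> space M |A. A \<in> sets (N j)}"
        using A inj by (auto simp: Pi_iff)
    qed (use J in auto)
    then show "prob (\<Inter>j\<in>J. A j) = (\<Prod>j\<in>J. prob (A j))"
      using inj by (simp add: prod.reindex)
  qed (use indep in \<open>auto simp: indep_vars_def2 indep_sets_def\<close>)
  then show ?thesis using indep by (auto simp: indep_vars_def2)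
qed

text \<open>With all coefficients zero the noise factor is \<open>sqrt (\<sigma>\<^sup>2)\<close>,
  that is \<open>\<bar>\<sigma>\<bar>\<close>, so each output is a function of its own noise
  variable. The condition on \<open>n\<close> makes the index set nonempty, as the product-measure
  form of independence demands.\<close>

lemma distr_memoryless_output_block:
  assumes "prob_space M" and U [measurable]: "\<And>k. U k \<in> borel_measurable M"
    and indep: "prob_space.indep_vars M (\<lambda>_. borel) U UNIV" and "n \<ge> 1"
  shows "distr M (block_space n) (output_block \<sigma> (\<lambda>_. 0) U n x) =
         PiM {1..n} (\<lambda>k. distr M borel (\<lambda>\<omega>. x k + \<bar>\<sigma>\<bar> * U (int k) \<omega>))"
proof -
  interpret prob_space M by fact
  have "indep_vars (\<lambda>_. borel) U (int ` {1..n})"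
    by (rule indep_vars_subset[OF indep]) auto
  then have "indep_vars (\<lambda>_. borel) (\<lambda>k. U (int k)) {1..n}"
    by (intro indep_vars_reindex[where f = int and X = U and N = "\<lambda>_. borel"]) auto
  then have "indep_vars (\<lambda>_. borel) (\<lambda>k \<omega>. x k + \<bar>\<sigma>\<bar> * U (int k) \<omega>) {1..n}"
    by (rule indep_vars_compose2[of _ _ _ "\<lambda>k u. x k + \<bar>\<sigma>\<bar> * u"]) measurable
  moreover have "output_block \<sigma> (\<lambda>_. 0) U n x = (\<lambda>\<omega>. \<lambda>k\<in>{1..n}. x k + \<bar>\<sigma>\<bar> * U (int k) \<omega>)"
    by (auto simp: fun_eq_iff output_block_def channel_output_def restrict_def)
  ultimately show ?thesis
    using \<open>n \<ge> 1\<close> by (simp add: indep_vars_iff_distr_eq_PiM del: restrict_apply)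
qed

text \<open>Rewrites the success probability, defined on the joint space of message and noise, as an
  average of masses of decoding regions, the form to which relative entropy bounds apply.\<close>

lemma error_prob_eq:
  assumes "prob_space M" and U [measurable]: "\<And>k. U k \<in> borel_measurable M"
    and W: "finite W" "W \<noteq> {}" and \<psi> [measurable]: "\<psi> \<in> measurable (block_space n) (count_space W)"
  shows "1 - error_prob \<sigma> \<alpha> M U n W \<phi> \<psi> =
    (\<Sum>m\<in>W. measure (distr M (block_space n) (output_block \<sigma> \<alpha> U n (\<phi> m)))
       (\<psi> -` {m} \<inter> space (block_space n))) / card W"
proof -
  interpret prob_space M by fact
  interpret N: prob_space "uniform_count_measure W"
    by (rule prob_space_uniform_count_measure) fact+
  interpret pair_prob_space "uniform_count_measure W" M ..
  let ?S = "uniform_count_measure W \<Otimes>\<^sub>M M"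
  let ?Y = "\<lambda>m. output_block \<sigma> \<alpha> U n (\<phi> m)"
  let ?C = "{p \<in> space ?S. \<psi> (?Y (fst p) (snd p)) = fst p}"
  have sets_W [measurable_cong]: "sets (uniform_count_measure W) = sets (count_space W)"
    by (simp add: sets_uniform_count_measure)
  \<comment> \<open>The message set is finite, so joint measurability reduces to measurability in
    the noise for each message separately.\<close>
  have dec: "(\<lambda>p. \<psi> (?Y (fst p) (snd p))) \<in> measurable ?S (count_space W)"
    unfolding measurable_cong_sets[OF sets_pair_measure_cong[OF sets_W refl] refl]
    using W by (intro measurable_pair_measure_countable1) (auto intro: countable_finite)
  have fst: "fst \<in> measurable ?S (count_space W)"
    by (subst measurable_cong_sets[OF refl sets_W[symmetric]]) (rule measurable_fst)
  have "?C = (\<Union>m\<in>W. ((\<lambda>p. \<psi> (?Y (fst p) (snd p))) -` {m} \<inter> space ?S) \<inter> (fst -` {m} \<inter> space ?S))"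
    by (auto simp: space_pair_measure space_uniform_count_measure)
  also have "\<dots> \<in> sets ?S"
    using W by (intro sets.finite_UN sets.Int measurable_sets[OF dec] measurable_sets[OF fst]) auto
  finally have C [measurable]: "?C \<in> sets ?S" .
  have "1 - error_prob \<sigma> \<alpha> M U n W \<phi> \<psi> = measure ?S ?C"
    unfolding error_prob_def
    by (subst P.prob_neg) measurable
  also have "\<dots> = (\<integral>p. indicator ?C p \<partial>?S)" by simp
  also have "\<dots> = (\<integral>m. (\<integral>\<omega>. indicator ?C (m, \<omega>) \<partial>M) \<partial>uniform_count_measure W)"
    by (rule integral_fst'[symmetric]) (auto intro!: P.integrable_bounded[of _ 1])
  also have "\<dots> = (\<Sum>m\<in>W. \<integral>\<omega>. indicator ?C (m, \<omega>) \<partial>M) / card W"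
    by (rule integral_uniform_count_measure) fact
  also have "(\<Sum>m\<in>W. \<integral>\<omega>. indicator ?C (m, \<omega>) \<partial>M) = (\<Sum>m\<in>W. measure (distr M (block_space n) (?Y m))
       (\<psi> -` {m} \<inter> space (block_space n)))"
  proof (rule sum.cong)
    fix m assume m: "m \<in> W"
    have "(\<integral>\<omega>. indicator ?C (m, \<omega>) \<partial>M) = (\<integral>\<omega>. indicator (?Y m -` (\<psi> -` {m} \<inter> space (block_space n)) \<inter> space M) \<omega> \<partial>M :: real)"
      using m measurable_space[OF measurable_output_block[OF U]]
      by (intro Bochner_Integration.integral_cong)
         (auto simp: indicator_def space_pair_measure space_uniform_count_measure)
    also have "\<dots> = measure M (?Y m -` (\<psi> -` {m} \<inter> space (block_space n)) \<inter> space M)"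
      by simp
    also have "\<dots> = measure (distr M (block_space n) (?Y m)) (\<psi> -` {m} \<inter> space (block_space n))"
      using m by (intro measure_distr[symmetric] measurable_sets[OF \<psi>] measurable_output_block U) auto
    finally show "(\<integral>\<omega>. indicator ?C (m, \<omega>) \<partial>M) = \<dots>" .
  qed simp
  finally show ?thesis .
qed

lemma (in prob_space) expectation_exp_indicator:
  fixes c :: real
  assumes [measurable]: "A \<in> events"
  shows "(\<integral>x. exp (c * indicator A x) \<partial>M) = 1 + (exp c - 1) * prob A"
proof -
  have "(\<integral>x. exp (c * indicator A x) \<partial>M) = (\<integral>x. 1 + (exp c - 1) * indicator A x \<partial>M)"
    by (intro Bochner_Integration.integral_cong) (auto simp: indicator_def)
  also have "\<dots> = 1 + (exp c - 1) * prob A"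
    using prob_space integrable_bounded[of "indicat_real A" 1] by (subst Bochner_Integration.integral_add) auto
  finally show ?thesis .
qed

section \<open>Bounds on code size and rate\<close>

text \<open>The decoding regions are disjoint, so under the output law \<open>?Q\<close> of the zero
  codeword their masses sum to at most 1. Moving from \<open>?Q\<close> to the output law of a
  codeword costs relative entropy at most \<open>K\<close> times the energy of the codeword, and
  averaging over messages brings in the power constraint.\<close>

lemma code_size_le:
  assumes M: "prob_space M" and U: "\<And>k. U k \<in> borel_measurable M"
    and indep: "prob_space.indep_vars M (\<lambda>_. borel) U UNIV"
    and "\<sigma> > 0" "K \<ge> 0" "n \<ge> 1" and code: "is_code n P W \<phi> \<psi>"
    and D: "\<And>k a. relative_entropy_le (distr M borel (\<lambda>\<omega>. a + \<sigma> * U k \<omega>))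
              (distr M borel (\<lambda>\<omega>. \<sigma> * U k \<omega>)) (K * a\<^sup>2)"
  shows "(1 - error_prob \<sigma> (\<lambda>_. 0) M U n W \<phi> \<psi>) * ln (card W) \<le> 1 + K * P * n"
proof -
  interpret prob_space M by fact
  note [measurable] = U
  from code have W: "finite W" "W \<noteq> {}"
    and \<psi> [measurable]: "\<psi> \<in> measurable (block_space n) (count_space W)"
    and pow: "(\<Sum>k=1..n. (\<Sum>m\<in>W. (\<phi> m k)\<^sup>2) / card W) / n \<le> P"
    by (auto simp: is_code_def integral_uniform_count_measure)
  define N where "N = card W"
  have N: "N \<ge> 1" using W by (auto simp: N_def Suc_le_eq card_gt_0_iff)
  let ?P = "\<lambda>x. PiM {1..n} (\<lambda>k. distr M borel (\<lambda>\<omega>. x k + \<sigma> * U (int k) \<omega>))"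
  let ?Q = "PiM {1..n} (\<lambda>k. distr M borel (\<lambda>\<omega>. \<sigma> * U (int k) \<omega>))"
  let ?A = "\<lambda>m. \<psi> -` {m} \<inter> space (block_space n)"
  have sP: "sets (?P x) = sets (block_space n)" for x by (intro sets_PiM_cong) auto
  have sQ: "sets ?Q = sets (block_space n)" by (intro sets_PiM_cong) auto
  have pP: "prob_space (?P x)" for x by (intro prob_space_PiM prob_space_distr) measurable
  interpret Q: prob_space ?Q by (intro prob_space_PiM prob_space_distr) measurable
  have A: "?A m \<in> sets (block_space n)" if "m \<in> W" for m
    using that by (intro measurable_sets[OF \<psi>]) auto
  have m_bound: "measure (?P (\<phi> m)) (?A m) * ln N \<le> K * (\<Sum>k=1..n. (\<phi> m k)\<^sup>2) + (N - 1) * measure ?Q (?A m)"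
    if m: "m \<in> W" for m
  proof -
    interpret P: prob_space "?P (\<phi> m)" by (rule pP)
    have AQ [measurable]: "?A m \<in> sets ?Q" using A[OF m] by (simp only: sQ)
    have [measurable]: "?A m \<in> sets (?P (\<phi> m))" using A[OF m] by (simp only: sP)
    \<comment> \<open>The height \<open>ln N\<close> makes the exponential moment under
      \<open>?Q\<close> equal to 1 plus \<open>N - 1\<close> times the mass of the region. By
      \<open>ln (1 + t) \<le> t\<close> its logarithm is at most that multiple of the mass; averaged
      over the messages it accounts for the summand 1 in the conclusion.\<close>
    let ?g = "\<lambda>y. ln N * indicator (?A m) y :: real"
    have "relative_entropy_le (?P (\<phi> m)) ?Q (K * (\<Sum>k=1..n. (\<phi> m k)\<^sup>2))"
      unfolding sum_distrib_left by (intro relative_entropy_le_PiM prob_space_distr D) auto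
    then have kl: "(\<integral>y. ?g y \<partial>?P (\<phi> m)) \<le> K * (\<Sum>k=1..n. (\<phi> m k)\<^sup>2) + ln (\<integral>y. exp (?g y) \<partial>?Q)"
    proof (rule relative_entropy_leD)
      show "?g \<in> borel_measurable ?Q" by measurable
      show "\<bar>?g y\<bar> \<le> ln N" for y using N by (auto simp: indicator_def)
    qed
    have eqP: "(\<integral>y. ?g y \<partial>?P (\<phi> m)) = measure (?P (\<phi> m)) (?A m) * ln N"
      by (simp add: sets_eq_imp_space_eq[OF sP] Int_assoc)
    have eqQ: "(\<integral>y. exp (?g y) \<partial>?Q) = 1 + (N - 1) * measure ?Q (?A m)"
      using Q.expectation_exp_indicator[OF AQ, of "ln N"] N by (simp add: of_nat_diff)
    have "ln (1 + (N - 1) * measure ?Q (?A m)) \<le> (N - 1) * measure ?Q (?A m)"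
      by (rule ln_add_one_self_le_self) simp
    then show ?thesis using kl unfolding eqP eqQ by linarith
  qed
  have sumQ: "(\<Sum>m\<in>W. measure ?Q (?A m)) \<le> 1"
  proof -
    have "(\<Sum>m\<in>W. measure ?Q (?A m)) = measure ?Q (\<Union>m\<in>W. ?A m)"
      using W A unfolding sQ[symmetric]
      by (intro Q.finite_measure_finite_Union[symmetric]) (auto simp: disjoint_family_on_def)
    then show ?thesis using Q.prob_le_1 by (simp only:)
  qed
  have pow': "(\<Sum>m\<in>W. \<Sum>k=1..n. (\<phi> m k)\<^sup>2) \<le> P * n * N"
  proof -
    have "(\<Sum>m\<in>W. \<Sum>k=1..n. (\<phi> m k)\<^sup>2) = (\<Sum>k=1..n. \<Sum>m\<in>W. (\<phi> m k)\<^sup>2)" by (rule sum.swap)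
    also have "\<dots> = (\<Sum>k=1..n. (\<Sum>m\<in>W. (\<phi> m k)\<^sup>2) / card W) / n * (n * N)"
      using N \<open>n \<ge> 1\<close> by (simp add: sum_divide_distrib[symmetric] N_def)
    also have "\<dots> \<le> P * (n * N)" by (intro mult_right_mono pow) simp
    finally show ?thesis by (simp add: mult.assoc)
  qed
  have "(1 - error_prob \<sigma> (\<lambda>_. 0) M U n W \<phi> \<psi>) = (\<Sum>m\<in>W. measure (?P (\<phi> m)) (?A m)) / N"
    using error_prob_eq[OF M U W \<psi>, where \<sigma> = \<sigma> and \<alpha> = "\<lambda>_. 0" and \<phi> = \<phi>] distr_memoryless_output_block[OF M U indep \<open>n \<ge> 1\<close>] \<open>\<sigma> > 0\<close>
    by (simp add: N_def)
  then have "N * ((1 - error_prob \<sigma> (\<lambda>_. 0) M U n W \<phi> \<psi>) * ln N) = (\<Sum>m\<in>W. measure (?P (\<phi> m)) (?A m) * ln N)"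
    using N by (simp add: sum_distrib_right)
  also have "\<dots> \<le> (\<Sum>m\<in>W. K * (\<Sum>k=1..n. (\<phi> m k)\<^sup>2) + (N - 1) * measure ?Q (?A m))"
    by (intro sum_mono m_bound)
  also have "\<dots> = K * (\<Sum>m\<in>W. \<Sum>k=1..n. (\<phi> m k)\<^sup>2) + (N - 1) * (\<Sum>m\<in>W. measure ?Q (?A m))"
    by (simp add: sum.distrib sum_distrib_left)
  also have "\<dots> \<le> K * (P * n * N) + real (N - 1) * 1"
    using \<open>K \<ge> 0\<close> by (intro add_mono mult_left_mono pow' sumQ) auto
  also have "\<dots> \<le> N * (1 + K * P * n)" using N by (simp add: algebra_simps of_nat_diff)
  finally show ?thesis using N by (simp add: N_def)
qed

text \<open>A weak converse: dividing the bound on the code size by \<open>n\<close> and by the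
  success probability leaves a right-hand side that tends to \<open>K * P\<close>, because the error
  probability vanishes.\<close>

lemma achievable_rate_le:
  assumes M: "prob_space M" and U: "\<And>k. U k \<in> borel_measurable M"
    and indep: "prob_space.indep_vars M (\<lambda>_. borel) U UNIV"
    and "\<sigma> > 0" "K \<ge> 0"
    and D: "\<And>k a. relative_entropy_le (distr M borel (\<lambda>\<omega>. a + \<sigma> * U k \<omega>))
              (distr M borel (\<lambda>\<omega>. \<sigma> * U k \<omega>)) (K * a\<^sup>2)"
    and R: "achievable \<sigma> (\<lambda>_. 0) M U P R"
  shows "R \<le> K * P"
proof -
  from R obtain W \<phi> \<psi> where code: "\<And>n. n \<ge> 1 \<Longrightarrow> is_code n P (W n) (\<phi> n) (\<psi> n)"
    and rate: "ereal R \<le> liminf (\<lambda>n. ereal (ln (real (card (W n))) / real n))"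
    and err: "(\<lambda>n. error_prob \<sigma> (\<lambda>_. 0) M U n (W n) (\<phi> n) (\<psi> n)) \<longlonglongrightarrow> 0" (is "?e \<longlonglongrightarrow> 0")
    unfolding achievable_def by blast
  let ?b = "\<lambda>n. (1 / real n + K * P) / (1 - ?e n)"
  have "?b \<longlonglongrightarrow> (0 + K * P) / (1 - 0)"
    by (intro tendsto_intros err lim_1_over_n) simp
  then have "(\<lambda>n. ereal (?b n)) \<longlonglongrightarrow> ereal (K * P)" by simp
  then have "liminf (\<lambda>n. ereal (?b n)) = ereal (K * P)" by (rule lim_imp_Liminf[rotated]) simp
  moreover have "\<forall>\<^sub>F n in sequentially. ?e n < 1"
    using err by (rule order_tendstoD) simp
  then have "\<forall>\<^sub>F n in sequentially. ereal (ln (real (card (W n))) / real n) \<le> ereal (?b n)"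
    using eventually_ge_at_top[of 1]
  proof eventually_elim
    case (elim n)
    have "(1 - ?e n) * ln (card (W n)) \<le> 1 + K * P * n"
      using code_size_le[OF M U indep \<open>\<sigma> > 0\<close> \<open>K \<ge> 0\<close> elim(2) code[OF elim(2)] D] .
    then have "ln (card (W n)) \<le> (1 + K * P * n) / (1 - ?e n)"
      using elim(1) by (simp add: pos_le_divide_eq mult.commute)
    then have "ln (card (W n)) / n \<le> (1 + K * P * n) / (1 - ?e n) / n"
      by (rule divide_right_mono) simp
    also have "\<dots> = (1 + K * P * n) / n / (1 - ?e n)" by simp
    also have "(1 + K * P * n) / n = 1 / n + K * P"
      using elim(2) by (simp add: add_divide_distrib)
    finally show ?case by simp
  qed
  then have "liminf (\<lambda>n. ereal (ln (real (card (W n))) / real n)) \<le> liminf (\<lambda>n. ereal (?b n))"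
    by (rule Liminf_mono)
  ultimately show ?thesis using rate order_trans by fastforce
qed

subsection \<open>A lower bound on mutual information\<close>

text \<open>On the set where \<open>f\<close> exceeds \<open>C\<close>, domination forces the
  integral of the excess to be zero, so the excess vanishes almost everywhere.\<close>

lemma AE_density_le:
  assumes "prob_space N" "prob_space J" and sets: "sets J = sets N"
    and le: "\<And>E. E \<in> sets N \<Longrightarrow> emeasure J E \<le> ennreal C * emeasure N E"
    and f [measurable]: "f \<in> borel_measurable N" and J: "J = density N f"
  shows "AE x in N. f x \<le> ennreal C"
proof -
  interpret N: prob_space N by fact
  interpret J: prob_space J by fact
  let ?E = "{x \<in> space N. ennreal C < f x}"
  have "(\<integral>\<^sup>+x. (f x - ennreal C) * indicator ?E x \<partial>N) =
      (\<integral>\<^sup>+x. f x * indicator ?E x - ennreal C * indicator ?E x \<partial>N)"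
    by (intro nn_integral_cong) (auto simp: indicator_def)
  also have "\<dots> = (\<integral>\<^sup>+x. f x * indicator ?E x \<partial>N) - (\<integral>\<^sup>+x. ennreal C * indicator ?E x \<partial>N)"
  proof (rule nn_integral_diff)
    have "(\<integral>\<^sup>+x. ennreal C * indicator ?E x \<partial>N) = ennreal C * emeasure N ?E"
      by (rule nn_integral_cmult_indicator) simp
    then show "(\<integral>\<^sup>+x. ennreal C * indicator ?E x \<partial>N) \<noteq> \<infinity>"
      by (simp add: ennreal_mult_eq_top_iff N.emeasure_eq_measure)
  qed (auto simp: indicator_def)
  also have "\<dots> = emeasure J ?E - ennreal C * emeasure N ?E"
    by (simp add: J emeasure_density nn_integral_cmult_indicator)
  also have "\<dots> = 0"
    using le[of ?E] by (simp add: diff_eq_0_iff_ennreal J.emeasure_eq_measure less_top[symmetric])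
  finally have "AE x in N. (f x - ennreal C) * indicator ?E x = 0"
    by (subst (asm) nn_integral_0_iff_AE) auto
  then show ?thesis
    by (auto elim!: eventually_mono simp: indicator_def diff_eq_0_iff_ennreal not_less split: if_splits)
qed

text \<open>
  The domination hypothesis makes the density bounded, hence the entropy density integrable; otherwise
  the Bochner integral in \<^const>\<open>KL_divergence\<close> could be the junk value \<open>0\<close>.
\<close>

lemma KL_divergence_ge:
  fixes G :: "'b \<Rightarrow> real"
  assumes N: "prob_space N" and J: "prob_space J" and sets: "sets J = sets N"
    and le: "\<And>E. E \<in> sets N \<Longrightarrow> emeasure J E \<le> ennreal C * emeasure N E"
    and G [measurable]: "G \<in> borel_measurable N" and B: "\<And>x. \<bar>G x\<bar> \<le> B"
    and exp_le: "(\<integral>x. exp (G x) \<partial>N) \<le> 1"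
  shows "(\<integral>x. G x \<partial>J) \<le> KL_divergence (exp 1) N J"
proof -
  interpret N: prob_space N by fact
  interpret J: prob_space J by fact
  \<comment> \<open>Enlarging the constant keeps the domination and makes it positive, so that
    bounds carry over from \<open>ennreal\<close> to \<open>real\<close>.\<close>
  define C' where "C' = max C 1"
  have C': "emeasure J E \<le> ennreal C' * emeasure N E" if "E \<in> sets N" for E
    using le[OF that] by (rule order_trans) (auto simp: C'_def intro!: mult_right_mono ennreal_leI)
  have "C' \<ge> 1" by (simp add: C'_def)
  have ac: "absolutely_continuous N J"
    unfolding absolutely_continuous_def
  proof
    fix E assume E: "E \<in> null_sets N"
    then have "emeasure J E \<le> 0" using C'[of E] by (simp add: null_setsD1 null_setsD2)
    then show "E \<in> null_sets J" using E by (auto simp: sets intro!: null_setsI)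
  qed
  define r where "r = (\<lambda>x. enn2real (RN_deriv N J x))"
  have [measurable]: "r \<in> borel_measurable N" by (simp add: r_def)
  have r0: "0 \<le> r x" for x by (simp add: r_def)
  have J_r: "J = density N (\<lambda>x. ennreal (r x))"
  proof -
    have "density N (\<lambda>x. ennreal (r x)) = density N (RN_deriv N J)"
      using N.RN_deriv_finite[OF J.sigma_finite_measure_axioms ac sets]
      by (intro density_cong) (auto simp: r_def less_top)
    then show ?thesis using N.density_RN_deriv[OF ac sets] by simp
  qed
  have "AE x in N. ennreal (r x) \<le> ennreal C'"
    by (rule AE_density_le[OF N J sets C' _ J_r]) auto
  then have r_le: "AE x in N. r x \<le> C'"
    by eventually_elim (use \<open>C' \<ge> 1\<close> in simp)
  \<comment> \<open>The upper bound comes from \<open>ln t \<le> t\<close>; the lower bound -1 comes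
    from \<open>ln s \<le> s - 1\<close> at \<open>s = 1 / t\<close>.\<close>
  have xlnx: "\<bar>t * ln t\<bar> \<le> C' * C' + 1" if "0 \<le> t" "t \<le> C'" for t :: real
  proof (cases "t = 0")
    case True
    then show ?thesis using \<open>C' \<ge> 1\<close> by simp
  next
    case False
    then have t: "t > 0" using that by simp
    have "t * ln t \<le> C' * C'"
    proof -
      have "t * ln t \<le> t * t" using t ln_bound[OF t] by (intro mult_left_mono) auto
      also have "\<dots> \<le> C' * C'" using that by (intro mult_mono) auto
      finally show ?thesis .
    qed
    moreover have "- 1 \<le> t * ln t"
    proof -
      have "ln (1 / t) \<le> 1 / t - 1" using t by (intro ln_le_minus_one) simp
      then have "- ln t \<le> 1 / t - 1" using t by (simp add: ln_div)
      then have "t * (- ln t) \<le> t * (1 / t - 1)" using t by (intro mult_left_mono) auto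
      then show ?thesis using t by (simp add: algebra_simps)
    qed
    ultimately show ?thesis using \<open>C' \<ge> 1\<close> by (auto simp: abs_le_iff intro: order_trans[of _ "1"])
  qed
  have int_ln: "integrable N (\<lambda>x. r x * ln (r x))"
    using r_le xlnx r0 by (intro N.integrable_const_bound[of _ "C' * C' + 1"]) (auto elim!: eventually_mono)
  have int_G: "integrable N (\<lambda>x. r x * G x)"
  proof (intro N.integrable_const_bound[of _ "C' * B"])
    show "AE x in N. norm (r x * G x) \<le> C' * B"
      using r_le
    proof eventually_elim
      case (elim x)
      have "\<bar>r x\<bar> * \<bar>G x\<bar> \<le> C' * B"
        using elim r0[of x] B[of x] \<open>C' \<ge> 1\<close> by (intro mult_mono) auto
      then show ?case by (simp add: abs_mult)
    qed
  qed measurable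
  have int_r: "integrable N r"
    using r_le r0 by (intro N.integrable_const_bound[of _ C']) auto
  have r1: "(\<integral>x. r x \<partial>N) = 1"
    using J.prob_space r0 integral_real_density[of r N "\<lambda>_. 1"] by (simp add: J_r[symmetric])
  have int_exp: "integrable N (\<lambda>x. exp (G x))"
    using B by (rule N.expectation_exp_bounds[OF G])
  have "KL_divergence (exp 1) N J = (\<integral>x. r x * ln (r x) \<partial>N)"
    unfolding J_r using r0 by (subst N.KL_density) (auto simp: log_def)
  moreover have "(\<integral>x. G x \<partial>J) = (\<integral>x. r x * G x \<partial>N)"
    unfolding J_r using r0 by (subst integral_real_density) auto
  \<comment> \<open>Young's inequality for the pair \<open>r ln r\<close> and \<open>exp\<close>:
    pointwise it is \<open>ln s \<le> s - 1\<close> at \<open>s = exp (G x) / r x\<close>, and where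
    \<open>r\<close> vanishes it says that \<open>exp\<close> is nonnegative. After integration the
    two extra terms contribute at most 1 - 1.\<close>
  moreover have "(\<integral>x. r x * G x \<partial>N) \<le> (\<integral>x. r x * ln (r x) + (exp (G x) - r x) \<partial>N)"
  proof (rule integral_mono)
    fix x
    show "r x * G x \<le> r x * ln (r x) + (exp (G x) - r x)"
    proof (cases "r x = 0")
      case False
      then have r: "r x > 0" using r0[of x] by simp
      have "ln (exp (G x) / r x) \<le> exp (G x) / r x - 1"
        using r by (intro ln_le_minus_one) simp
      then have "G x - ln (r x) \<le> exp (G x) / r x - 1" using r by (simp add: ln_div)
      then have "r x * (G x - ln (r x)) \<le> r x * (exp (G x) / r x - 1)" using r by (intro mult_left_mono) auto
      then show ?thesis using r by (simp add: algebra_simps)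
    qed simp
  qed (use int_ln int_G int_exp int_r in auto)
  moreover have "\<dots> = (\<integral>x. r x * ln (r x) \<partial>N) + ((\<integral>x. exp (G x) \<partial>N) - 1)"
    using int_ln int_exp int_r r1 by simp
  ultimately show ?thesis using exp_le by linarith
qed

text \<open>Finite support of the input makes the joint law dominated by the product of the
  marginals, so \<open>KL_divergence_ge\<close> applies. As \<open>exp_le\<close> normalizes the
  score for each output separately, its exponential moment under the product is at most 1 whatever
  the output law is.\<close>

lemma mutual_information_ge:
  fixes q :: "'x pmf" and G :: "'b \<times> 'c \<Rightarrow> real"
  assumes "prob_space M" and fin: "finite (set_pmf q)"
    and e [measurable]: "e \<in> measurable (measure_pmf q) S"
    and Y [measurable]: "(\<lambda>(x, \<omega>). Y x \<omega>) \<in> measurable (S \<Otimes>\<^sub>M M) T"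
    and G [measurable]: "G \<in> borel_measurable (S \<Otimes>\<^sub>M T)" and B: "\<And>p. \<bar>G p\<bar> \<le> B"
    and exp_le: "\<And>y. y \<in> space T \<Longrightarrow> (\<integral>x. exp (G (e x, y)) \<partial>q) \<le> 1"
  shows "(\<integral>x. (\<integral>\<omega>. G (e x, Y (e x) \<omega>) \<partial>M) \<partial>q)
    \<le> prob_space.mutual_information (distr q S e \<Otimes>\<^sub>M M) (exp 1) S T fst (\<lambda>(x, \<omega>). Y x \<omega>)"
proof -
  interpret M: prob_space M by fact
  let ?\<mu> = "distr q S e"
  interpret \<mu>: prob_space ?\<mu> by (rule measure_pmf.prob_space_distr) fact
  interpret pair_prob_space ?\<mu> M ..
  let ?S = "?\<mu> \<Otimes>\<^sub>M M"
  let ?Y = "\<lambda>(x, \<omega>). Y x \<omega>"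
  let ?PY = "distr ?S T ?Y"
  have [simp]: "e x \<in> space S" for x using measurable_space[OF e, of x] by simp
  have [measurable]: "?Y \<in> measurable ?S T" using Y by simp
  have [measurable]: "fst \<in> measurable ?S S" by measurable
  interpret PY: prob_space ?PY by (rule P.prob_space_distr) measurable
  have distr_fst: "distr ?S S fst = ?\<mu>"
    using M.distr_pair_fst[of ?\<mu>] by (simp cong: distr_cong)
  let ?N = "?\<mu> \<Otimes>\<^sub>M ?PY"
  let ?J = "distr ?S (S \<Otimes>\<^sub>M T) (\<lambda>p. (fst p, ?Y p))"
  interpret N: pair_prob_space ?\<mu> ?PY ..
  have N: "prob_space ?N" by (rule N.P.prob_space_axioms)
  have J: "prob_space ?J" by (rule P.prob_space_distr) measurable
  have sets: "sets ?J = sets ?N" by simp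
  \<comment> \<open>The output law is a mixture that gives weight \<open>pmf q x\<close> to the law
    for input \<open>x\<close>, so the latter is at most \<open>1 / pmf q x\<close> times the
    former. The sum dominates each of these factors.\<close>
  define C where "C = (\<Sum>x\<in>set_pmf q. 1 / pmf q x)"
  have nn_S: "(\<integral>\<^sup>+p. h p \<partial>?S) = (\<integral>\<^sup>+x. \<integral>\<^sup>+\<omega>. h (e x, \<omega>) \<partial>M \<partial>q)"
    if [measurable]: "h \<in> borel_measurable (S \<Otimes>\<^sub>M M)" for h
    by (subst M.nn_integral_fst[symmetric], simp, subst nn_integral_distr) auto
  have nn_PY: "(\<integral>\<^sup>+y. h y \<partial>?PY) = (\<integral>\<^sup>+x. \<integral>\<^sup>+\<omega>. h (Y (e x) \<omega>) \<partial>M \<partial>q)"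
    if [measurable]: "h \<in> borel_measurable T" for h
    by (simp add: nn_integral_distr nn_S)
  have Y_le: "(\<integral>\<^sup>+\<omega>. h (Y (e x) \<omega>) \<partial>M) \<le> ennreal C * (\<integral>\<^sup>+y. h y \<partial>?PY)" (is "?h x \<le> _")
    if x: "x \<in> set_pmf q" and [measurable]: "h \<in> borel_measurable T" for x h
  proof -
    have p: "pmf q x > 0" using x by (rule pmf_positive)
    have "ennreal (pmf q x) * ?h x \<le> (\<Sum>x\<in>set_pmf q. ?h x * ennreal (pmf q x))"
      using fin x by (subst mult.commute) (rule member_le_sum, auto)
    also have "\<dots> = (\<integral>\<^sup>+y. h y \<partial>?PY)"
      using fin by (simp add: nn_PY nn_integral_measure_pmf_finite)
    finally have "ennreal (1 / pmf q x) * (ennreal (pmf q x) * ?h x) \<le> ennreal (1 / pmf q x) * (\<integral>\<^sup>+y. h y \<partial>?PY)"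
      by (rule mult_left_mono) simp
    also have "ennreal (1 / pmf q x) * (ennreal (pmf q x) * ?h x) = ?h x"
      using p by (simp add: mult.assoc[symmetric] ennreal_mult[symmetric])
    also have "ennreal (1 / pmf q x) * (\<integral>\<^sup>+y. h y \<partial>?PY) \<le> ennreal C * (\<integral>\<^sup>+y. h y \<partial>?PY)"
      unfolding C_def using fin x by (intro mult_right_mono ennreal_leI member_le_sum) auto
    finally show ?thesis .
  qed
  have le: "emeasure ?J E \<le> ennreal C * emeasure ?N E" if "E \<in> sets ?N" for E
  proof -
    from that have [measurable]: "E \<in> sets (S \<Otimes>\<^sub>M T)" by simp
    have "emeasure ?J E = (\<integral>\<^sup>+p. indicator E p \<partial>?J)" by simp
    also have "\<dots> = (\<integral>\<^sup>+p. indicator E (fst p, ?Y p) \<partial>?S)" by (rule nn_integral_distr) measurable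
    also have "\<dots> = (\<integral>\<^sup>+x. \<integral>\<^sup>+\<omega>. indicator E (e x, Y (e x) \<omega>) \<partial>M \<partial>q)"
      by (subst nn_S) auto
    also have "\<dots> \<le> (\<integral>\<^sup>+x. ennreal C * (\<integral>\<^sup>+y. indicator E (e x, y) \<partial>?PY) \<partial>q)"
      by (intro nn_integral_mono_AE) (auto simp: AE_measure_pmf_iff intro!: Y_le)
    also have "\<dots> = ennreal C * (\<integral>\<^sup>+x. \<integral>\<^sup>+y. indicator E (e x, y) \<partial>?PY \<partial>q)"
      by (rule nn_integral_cmult) simp
    also have "(\<integral>\<^sup>+x. \<integral>\<^sup>+y. indicator E (e x, y) \<partial>?PY \<partial>q) = (\<integral>\<^sup>+p. indicator E p \<partial>?N)"
      by (subst PY.nn_integral_fst[symmetric], simp, subst nn_integral_distr) auto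
    finally show ?thesis by simp
  qed
  have "(\<integral>p. G p \<partial>?J) \<le> KL_divergence (exp 1) ?N ?J"
  proof (rule KL_divergence_ge[OF N J sets le])
    have "integrable ?N (\<lambda>p. exp (G p))"
      using B by (intro N.P.expectation_exp_bounds[of _ B]) auto
    then have "(\<integral>p. exp (G p) \<partial>?N) = (\<integral>y. (\<integral>x. exp (G (x, y)) \<partial>?\<mu>) \<partial>?PY)"
      using N.integral_snd[of "\<lambda>x y. exp (G (x, y))"] by (simp add: case_prod_unfold)
    also have "\<dots> = (\<integral>y. (\<integral>x. exp (G (e x, y)) \<partial>q) \<partial>?PY)"
      by (intro Bochner_Integration.integral_cong) (auto simp: integral_distr)
    also have "\<dots> \<le> 1"
    \<comment> \<open>If the inner integral is not integrable, its Bochner integral is 0 by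
      convention and the bound holds as well.\<close>
    proof (cases "integrable ?PY (\<lambda>y. \<integral>x. exp (G (e x, y)) \<partial>q)")
      case True
      then show ?thesis by (rule PY.integral_le_const) (auto intro!: AE_I2 exp_le)
    qed (simp add: not_integrable_integral_eq)
    finally show "(\<integral>p. exp (G p) \<partial>?N) \<le> 1" .
  qed (use B in auto)
  moreover have "(\<integral>p. G p \<partial>?J) = (\<integral>x. (\<integral>\<omega>. G (e x, Y (e x) \<omega>) \<partial>M) \<partial>q)"
  proof -
    have "(\<integral>p. G p \<partial>?J) = (\<integral>p. G (fst p, ?Y p) \<partial>?S)" by (rule integral_distr) measurable
    also have "\<dots> = (\<integral>x. (\<integral>\<omega>. G (x, Y x \<omega>) \<partial>M) \<partial>?\<mu>)"
      using B by (subst integral_fst'[symmetric]) (auto intro!: P.integrable_bounded[of _ B])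
    also have "\<dots> = (\<integral>x. (\<integral>\<omega>. G (e x, Y (e x) \<omega>) \<partial>M) \<partial>q)"
      by (rule integral_distr) measurable
    finally show ?thesis .
  qed
  ultimately show ?thesis
    unfolding P.mutual_information_def distr_fst by simp
qed

subsection \<open>On-off signalling over the heating channel\<close>

lemma measurable_output_block_pair [measurable]:
  assumes [measurable]: "\<And>k. U k \<in> borel_measurable M"
  shows "(\<lambda>(x, \<omega>). output_block \<sigma> \<alpha> U n x \<omega>) \<in> measurable (block_space n \<Otimes>\<^sub>M M) (block_space n)"
proof -
  have "(\<lambda>p. \<lambda>k\<in>{1..n}. channel_output \<sigma> \<alpha> (fst p) (\<lambda>i. U (int i) (snd p)) k) \<in> measurable (block_space n \<Otimes>\<^sub>M M) (block_space n)"
  proof (rule measurable_restrict)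
    fix k assume k: "k \<in> {1..n}"
    have [measurable]: "(\<lambda>p. fst p l) \<in> borel_measurable (block_space n \<Otimes>\<^sub>M M)" if "l \<in> {1..k}" for l
      using that k by (intro measurable_compose[OF measurable_fst measurable_component_singleton]) auto
    show "(\<lambda>p. channel_output \<sigma> \<alpha> (fst p) (\<lambda>i. U (int i) (snd p)) k) \<in> borel_measurable (block_space n \<Otimes>\<^sub>M M)"
      unfolding channel_output_def using k by measurable
  qed
  then show ?thesis by (simp add: output_block_def[abs_def] case_prod_unfold)
qed

text \<open>Dominated convergence gives continuity at \<open>t = 0\<close>, hence error
  \<open>\<eta>\<close> for small \<open>t\<close>; for larger \<open>t\<close> the trivial bound
  \<open>2 * B\<close> fits under the linear term. An error that is affine in \<open>t\<close> can
  be averaged over random heat from the mean heat alone.\<close>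

lemma expectation_scaling_perturbation:
  fixes w :: "real \<Rightarrow> real" and \<nu> :: "real measure"
  assumes \<nu>: "prob_space \<nu>" "sets \<nu> = sets borel"
    and w: "continuous_on UNIV w" "\<And>y. \<bar>w y\<bar> \<le> B" and "\<eta> > 0"
  obtains \<kappa> where "\<kappa> \<ge> 0"
    "\<And>t. t \<ge> 0 \<Longrightarrow> \<bar>(\<integral>u. w (a + sqrt (\<sigma>\<^sup>2 + t) * u) \<partial>\<nu>) - (\<integral>u. w (a + \<bar>\<sigma>\<bar> * u) \<partial>\<nu>)\<bar> \<le> \<eta> + \<kappa> * t"
proof -
  interpret prob_space \<nu> by fact
  note [measurable_cong] = \<nu>(2)
  have [measurable]: "w \<in> borel_measurable borel" by (rule borel_measurable_continuous_onI[OF w(1)])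
  have B0: "B \<ge> 0" using w(2)[of 0] by simp
  define H where "H t = (\<integral>u. w (a + sqrt (\<sigma>\<^sup>2 + t) * u) \<partial>\<nu>)" for t
  have H_le: "\<bar>H t\<bar> \<le> B" for t
  proof -
    have "integrable \<nu> (\<lambda>u. w (a + sqrt (\<sigma>\<^sup>2 + t) * u))" by (rule integrable_bounded[of _ B]) (use w(2) in auto)
    moreover have "- B \<le> w y" "w y \<le> B" for y using w(2)[of y] by auto
    ultimately have "H t \<le> B" "- B \<le> H t"
      unfolding H_def by (auto intro!: integral_le_const integral_ge_const)
    then show ?thesis by linarith
  qed
  have "(H \<longlongrightarrow> H 0) (at 0)"
    unfolding tendsto_at_iff_sequentially
  proof (intro allI impI)
    fix X :: "nat \<Rightarrow> real" assume X: "X \<longlonglongrightarrow> 0"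
    have w_cont: "isCont w y" for y using w(1) by (simp add: continuous_on_eq_continuous_at)
    have "(\<lambda>i. w (a + sqrt (\<sigma>\<^sup>2 + X i) * u)) \<longlonglongrightarrow> w (a + sqrt (\<sigma>\<^sup>2 + 0) * u)" for u
      by (intro isCont_tendsto_compose[OF w_cont] tendsto_intros X)
    then show "(H \<circ> X) \<longlonglongrightarrow> H 0"
      unfolding H_def comp_def using w(2)
      by (intro integral_dominated_convergence[where w = "\<lambda>_. B"]) auto
  qed
  then have "\<forall>\<^sub>F t in at 0. dist (H t) (H 0) < \<eta>" using \<open>\<eta> > 0\<close> by (rule tendstoD)
  then obtain \<tau> where "\<tau> > 0" and \<tau>: "\<And>t. t \<noteq> 0 \<Longrightarrow> \<bar>t\<bar> < \<tau> \<Longrightarrow> \<bar>H t - H 0\<bar> < \<eta>"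
    by (auto simp: eventually_at dist_real_def)
  show thesis
  proof
    \<comment> \<open>The slope is chosen so that the linear term reaches the trivial bound
      \<open>2 * B\<close> exactly at \<open>t = \<tau>\<close>.\<close>
    show "2 * B / \<tau> \<ge> 0" using B0 \<open>\<tau> > 0\<close> by simp
    fix t :: real assume "t \<ge> 0"
    have "\<bar>H t - H 0\<bar> \<le> \<eta> + 2 * B / \<tau> * t"
    proof (cases "t < \<tau>")
      case True
      then have "\<bar>H t - H 0\<bar> \<le> \<eta>" using \<tau>[of t] \<open>t \<ge> 0\<close> \<open>\<eta> > 0\<close> by (cases "t = 0") auto
      moreover have "0 \<le> 2 * B / \<tau> * t" using B0 \<open>\<tau> > 0\<close> \<open>t \<ge> 0\<close> by simp
      ultimately show ?thesis by linarith
    next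
      case False
      have "1 \<le> t / \<tau>" using False \<open>\<tau> > 0\<close> by simp
      then have "2 * B * 1 \<le> 2 * B * (t / \<tau>)" using B0 by (intro mult_left_mono) auto
      moreover have "\<bar>H t - H 0\<bar> \<le> 2 * B" using H_le[of t] H_le[of 0] by linarith
      ultimately show ?thesis using \<open>\<eta> > 0\<close> by (simp add: mult.commute)
    qed
    then show "\<bar>(\<integral>u. w (a + sqrt (\<sigma>\<^sup>2 + t) * u) \<partial>\<nu>) - (\<integral>u. w (a + \<bar>\<sigma>\<bar> * u) \<partial>\<nu>)\<bar> \<le> \<eta> + 2 * B / \<tau> * t"
      by (simp add: H_def)
  qed
qed

section \<open>IID on-off inputs\<close>

definition on_off_pmf :: "real \<Rightarrow> real \<Rightarrow> real pmf" where
  "on_off_pmf \<delta> x = map_pmf (\<lambda>b. if b then x else 0) (bernoulli_pmf \<delta>)"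

text \<open>\<open>Pi_pmf\<close> fills the coordinates outside the block with the default 0, while
  \<open>block_space\<close> consists of extensional functions; hence the \<open>restrict\<close>
  wherever this becomes an input law.\<close>

definition on_off_block :: "nat \<Rightarrow> real \<Rightarrow> real \<Rightarrow> (nat \<Rightarrow> real) pmf" where
  "on_off_block n \<delta> x = Pi_pmf {1..n} 0 (\<lambda>_. on_off_pmf \<delta> x)"

lemma finite_set_on_off_pmf [simp]: "finite (set_pmf (on_off_pmf \<delta> x))"
  unfolding on_off_pmf_def by simp

lemma finite_set_on_off_block [simp]: "finite (set_pmf (on_off_block n \<delta> x))"
  unfolding on_off_block_def by (subst set_Pi_pmf) (auto intro!: finite_PiE_dflt)

lemma integral_on_off_pmf:
  fixes f :: "real \<Rightarrow> real"
  assumes "0 \<le> \<delta>" "\<delta> \<le> 1"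
  shows "(\<integral>v. f v \<partial>on_off_pmf \<delta> x) = \<delta> * f x + (1 - \<delta>) * f 0"
  using assms by (simp add: on_off_pmf_def)

lemma integral_on_off_block_component:
  fixes f :: "real \<Rightarrow> real"
  assumes "0 \<le> \<delta>" "\<delta> \<le> 1" "k \<in> {1..n}"
  shows "(\<integral>v. f (v k) \<partial>on_off_block n \<delta> x) = \<delta> * f x + (1 - \<delta>) * f 0"
proof -
  have "map_pmf (\<lambda>v. v k) (on_off_block n \<delta> x) = on_off_pmf \<delta> x"
    unfolding on_off_block_def using assms by (subst Pi_pmf_component) auto
  then have "(\<integral>v. f (v k) \<partial>on_off_block n \<delta> x) = (\<integral>v. f v \<partial>on_off_pmf \<delta> x)"
    by (metis integral_map_pmf)
  then show ?thesis using assms by (simp add: integral_on_off_pmf)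
qed

text \<open>Both factors are placed in a product over all coordinates with factor 1 elsewhere, and
  independence splits its expectation. In the application \<open>f\<close> is the indicator of a
  pulse at time \<open>k\<close> and \<open>g\<close> the energy at an earlier time
  \<open>l\<close>.\<close>

lemma integral_on_off_block_pair:
  fixes f g :: "real \<Rightarrow> real"
  assumes "0 \<le> \<delta>" "\<delta> \<le> 1" "k \<in> {1..n}" "l \<in> {1..n}" "k \<noteq> l"
    and "\<And>v. 0 \<le> f v" "\<And>v. 0 \<le> g v"
  shows "(\<integral>v. f (v k) * g (v l) \<partial>on_off_block n \<delta> x) =
    (\<delta> * f x + (1 - \<delta>) * f 0) * (\<delta> * g x + (1 - \<delta>) * g 0)"
proof -
  let ?F = "\<lambda>i v. if i = k then f v else if i = l then g v else 1"
  have split: "(\<Prod>i\<in>{1..n}. c i) = c k * c l" if "\<And>i. i \<noteq> k \<Longrightarrow> i \<noteq> l \<Longrightarrow> c i = 1" for c :: "nat \<Rightarrow> real"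
  proof -
    have "(\<Prod>i\<in>{1..n}. c i) = (\<Prod>i\<in>{k, l}. c i)"
      using assms that by (intro prod.mono_neutral_right) auto
    then show ?thesis using assms by simp
  qed
  have "(\<integral>v. f (v k) * g (v l) \<partial>on_off_block n \<delta> x) = (\<integral>v. (\<Prod>i\<in>{1..n}. ?F i (v i)) \<partial>on_off_block n \<delta> x)"
    using assms(5) by (subst split) auto
  also have "\<dots> = (\<Prod>i\<in>{1..n}. \<integral>v. ?F i v \<partial>on_off_pmf \<delta> x)"
    unfolding on_off_block_def using assms
    by (intro expectation_prod_Pi_pmf) (auto intro: integrable_measure_pmf_finite)
  also have "\<dots> = (\<integral>v. f v \<partial>on_off_pmf \<delta> x) * (\<integral>v. g v \<partial>on_off_pmf \<delta> x)"
    using assms(5) by (subst split) auto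
  finally show ?thesis using assms by (simp add: integral_on_off_pmf)
qed

lemma on_off_block_values:
  assumes "v \<in> set_pmf (on_off_block n \<delta> x)"
  shows "v k = x \<or> v k = 0"
proof (cases "k \<in> {1..n}")
  case True
  then show ?thesis
    using assms unfolding on_off_block_def
    by (subst (asm) set_Pi_pmf) (auto simp: PiE_dflt_def on_off_pmf_def split: if_splits)
next
  case False
  then show ?thesis
    using assms set_Pi_pmf_subset[of "{1..n}" 0 "\<lambda>_. on_off_pmf \<delta> x"]
    unfolding on_off_block_def by auto
qed

lemma on_off_block_input_law:
  assumes "0 \<le> \<delta>" "\<delta> \<le> 1" "n \<ge> 1"
  shows "distr (on_off_block n \<delta> x) (block_space n) (\<lambda>v. restrict v {1..n}) \<in> input_laws n (\<delta> * x\<^sup>2)"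
proof -
  let ?e = "\<lambda>v. restrict v {1..n} :: nat \<Rightarrow> real"
  let ?q = "on_off_block n \<delta> x"
  have e [measurable]: "?e \<in> measurable (measure_pmf ?q) (block_space n)"
    by (auto simp: space_PiM)
  have "(\<integral>\<^sup>+v. ennreal ((v k)\<^sup>2) \<partial>distr ?q (block_space n) ?e) = ennreal (\<delta> * x\<^sup>2)"
    if k: "k \<in> {1..n}" for k
  proof -
    have "(\<integral>\<^sup>+v. ennreal ((v k)\<^sup>2) \<partial>distr ?q (block_space n) ?e) = (\<integral>\<^sup>+v. ennreal ((v k)\<^sup>2) \<partial>?q)"
      using k by (subst nn_integral_distr[OF e]) (auto simp: space_PiM)
    also have "\<dots> = ennreal (\<integral>v. (v k)\<^sup>2 \<partial>?q)"
      by (intro nn_integral_eq_integral integrable_measure_pmf_finite) auto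
    also have "(\<integral>v. (v k)\<^sup>2 \<partial>?q) = \<delta> * x\<^sup>2"
      using assms k by (simp add: integral_on_off_block_component[where f = "\<lambda>v. v\<^sup>2"])
    finally show ?thesis .
  qed
  then have "(\<Sum>k=1..n. \<integral>\<^sup>+v. ennreal ((v k)\<^sup>2) \<partial>distr ?q (block_space n) ?e) / of_nat n
      = of_nat n * ennreal (\<delta> * x\<^sup>2) / of_nat n"
    by simp
  also have "\<dots> = ennreal (\<delta> * x\<^sup>2)"
    using assms by (simp add: ennreal_of_nat_eq_real_of_nat ennreal_mult[symmetric] divide_ennreal)
  finally show ?thesis
    unfolding input_laws_def by (auto intro!: measure_pmf.prob_space_distr simp: space_PiM)
qed

text \<open>
  The log-likelihood ratio of a decoder that takes the output density to be \<open>e\<^bsup>g\<^esup>\<close> given input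
  \<open>x\<close> and \<open>1\<close> given input \<open>0\<close>. Dividing by the mixture normalizes its exponential for every output
  \<open>y\<close>, so the law of the outputs never has to be computed.
\<close>

definition on_off_score :: "(real \<Rightarrow> real) \<Rightarrow> real \<Rightarrow> real \<Rightarrow> real \<Rightarrow> real \<Rightarrow> real" where
  "on_off_score g \<delta> x a y = (if a = x then g y else 0) - ln (1 - \<delta> + \<delta> * exp (g y))"

lemma measurable_on_off_score [measurable]:
  assumes [measurable]: "g \<in> borel_measurable borel" "f \<in> borel_measurable N" "h \<in> borel_measurable N"
  shows "(\<lambda>p. on_off_score g \<delta> x (f p) (h p)) \<in> borel_measurable N"
  unfolding on_off_score_def by measurable

text \<open>A convex combination of 1 and \<open>exp t\<close>, both of which lie between
  \<open>exp (- B)\<close> and \<open>exp B\<close>.\<close>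

lemma on_off_mixture_bounds:
  fixes \<delta> t B :: real
  assumes "0 < \<delta>" "\<delta> < 1" "\<bar>t\<bar> \<le> B"
  shows "exp (- B) \<le> 1 - \<delta> + \<delta> * exp t" "1 - \<delta> + \<delta> * exp t \<le> exp B"
proof -
  have "(1 - \<delta>) * exp (- B) + \<delta> * exp (- B) \<le> (1 - \<delta>) * 1 + \<delta> * exp t"
    using assms by (intro add_mono mult_left_mono) auto
  then show "exp (- B) \<le> 1 - \<delta> + \<delta> * exp t" by (simp add: algebra_simps)
  have "(1 - \<delta>) * 1 + \<delta> * exp t \<le> (1 - \<delta>) * exp B + \<delta> * exp B"
    using assms by (intro add_mono mult_left_mono) auto
  then show "1 - \<delta> + \<delta> * exp t \<le> exp B" by (simp add: algebra_simps)
qed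

lemma on_off_score_bound:
  assumes "0 < \<delta>" "\<delta> < 1" "\<bar>g y\<bar> \<le> B"
  shows "\<bar>on_off_score g \<delta> x a y\<bar> \<le> 2 * B"
proof -
  note b = on_off_mixture_bounds[OF assms]
  have pos: "0 < 1 - \<delta> + \<delta> * exp (g y)" using b(1) exp_gt_zero[of "- B"] by linarith
  have "- B \<le> ln (1 - \<delta> + \<delta> * exp (g y))" using b(1) pos by (simp add: ln_ge_iff)
  moreover have "ln (1 - \<delta> + \<delta> * exp (g y)) \<le> B"
    using b(2) pos ln_le_cancel_iff[of _ "exp B"] by simp
  ultimately show ?thesis using assms(3) by (auto simp: on_off_score_def)
qed

text \<open>As \<open>x \<noteq> 0\<close> keeps the two input symbols distinct, the weighted
  numerators \<open>exp (g y)\<close> and 1 add up to the mixture in the denominator.\<close>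

lemma integral_exp_on_off_score:
  assumes "0 < \<delta>" "\<delta> < 1" "x \<noteq> 0"
  shows "(\<integral>a. exp (on_off_score g \<delta> x a y) \<partial>on_off_pmf \<delta> x) = 1"
proof -
  have pos: "0 < 1 - \<delta> + \<delta> * exp (g y)"
    using assms by (intro add_pos_pos) auto
  have "exp (ln (1 - \<delta> + \<delta> * exp (g y))) = 1 - \<delta> + \<delta> * exp (g y)"
    using pos by simp
  then show ?thesis
    using assms pos by (simp add: integral_on_off_pmf on_off_score_def exp_diff field_simps)
qed

text \<open>Linearizing the logarithm by \<open>ln s \<le> s - 1\<close> trades the mixture for
  \<open>exp (g y) - 1\<close>, the term that occurs in the variational expression.\<close>

lemma on_off_score_ge:
  assumes "0 < \<delta>" "\<delta> < 1"
  shows "(if a = x then g y else 0) - \<delta> * (exp (g y) - 1) \<le> on_off_score g \<delta> x a y"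
proof -
  have "0 < 1 - \<delta> + \<delta> * exp (g y)" using assms by (intro add_pos_pos) auto
  then have "ln (1 - \<delta> + \<delta> * exp (g y)) \<le> (1 - \<delta> + \<delta> * exp (g y)) - 1"
    by (rule ln_le_minus_one)
  then show ?thesis by (simp add: on_off_score_def algebra_simps)
qed

section \<open>Mean of the heat, the input-dependent part of the noise variance\<close>

definition heat :: "(nat \<Rightarrow> real) \<Rightarrow> (nat \<Rightarrow> real) \<Rightarrow> nat \<Rightarrow> real" where
  "heat \<alpha> v k = (\<Sum>l\<in>{1..<k}. \<alpha> (k - l) * (v l)\<^sup>2)"

lemma heat_nonneg: "(\<And>l. l \<ge> 1 \<Longrightarrow> \<alpha> l \<ge> 0) \<Longrightarrow> 0 \<le> heat \<alpha> v k"
  unfolding heat_def by (intro sum_nonneg mult_nonneg_nonneg) auto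

lemma sum_coefficients_le:
  fixes \<alpha> :: "nat \<Rightarrow> real"
  assumes "\<And>l. l \<ge> 1 \<Longrightarrow> \<alpha> l \<ge> 0" "summable (\<lambda>l. \<alpha> (Suc l))"
  shows "(\<Sum>l\<in>{1..<k}. \<alpha> (k - l)) \<le> (\<Sum>l. \<alpha> (Suc l))"
proof -
  have "(\<Sum>l\<in>{1..<k}. \<alpha> (k - l)) = (\<Sum>j<k - 1. \<alpha> (Suc j))"
    by (rule sum.reindex_bij_witness[of _ "\<lambda>j. k - Suc j" "\<lambda>l. k - Suc l"])
       (auto simp: Suc_diff_Suc)
  also have "\<dots> \<le> (\<Sum>l. \<alpha> (Suc l))"
    using assms by (intro sum_le_suminf) auto
  finally show ?thesis .
qed

text \<open>The heat at time \<open>k\<close> involves only inputs before \<open>k\<close>, which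
  are independent of a pulse at \<open>k\<close>. The second expectation therefore gains another
  factor \<open>\<delta>\<close>, which makes the influence of heat on the pulses of second order in
  \<open>\<delta>\<close>.\<close>

lemma expected_heat_le:
  assumes \<alpha>: "\<And>l. l \<ge> 1 \<Longrightarrow> \<alpha> l \<ge> 0" "summable (\<lambda>l. \<alpha> (Suc l))"
    and \<delta>: "0 \<le> \<delta>" "\<delta> \<le> 1" and k: "k \<in> {1..n}" and "x \<noteq> 0"
  shows "(\<integral>v. heat \<alpha> v k \<partial>on_off_block n \<delta> x) \<le> \<delta> * x\<^sup>2 * (\<Sum>l. \<alpha> (Suc l))"
    and "(\<integral>v. of_bool (v k = x) * heat \<alpha> v k \<partial>on_off_block n \<delta> x) \<le> \<delta> * (\<delta> * x\<^sup>2 * (\<Sum>l. \<alpha> (Suc l)))"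
proof -
  let ?q = "on_off_block n \<delta> x"
  have int: "integrable ?q f" for f :: "_ \<Rightarrow> real"
    by (rule integrable_measure_pmf_finite) simp
  have sum: "(\<Sum>l\<in>{1..<k}. \<alpha> (k - l)) \<le> (\<Sum>l. \<alpha> (Suc l))" by (rule sum_coefficients_le[OF \<alpha>])
  have "(\<integral>v. heat \<alpha> v k \<partial>?q) = (\<Sum>l\<in>{1..<k}. \<alpha> (k - l) * (\<integral>v. (v l)\<^sup>2 \<partial>?q))"
    unfolding heat_def by (subst Bochner_Integration.integral_sum) (auto intro: int)
  also have "\<dots> = (\<Sum>l\<in>{1..<k}. \<alpha> (k - l) * (\<delta> * x\<^sup>2))"
    using k \<delta> by (intro sum.cong) (auto simp: integral_on_off_block_component[where f = "\<lambda>v. v\<^sup>2"])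
  also have "\<dots> = \<delta> * x\<^sup>2 * (\<Sum>l\<in>{1..<k}. \<alpha> (k - l))" by (simp add: sum_distrib_left mult.commute)
  also have "\<dots> \<le> \<delta> * x\<^sup>2 * (\<Sum>l. \<alpha> (Suc l))" using \<delta> by (intro mult_left_mono sum) auto
  finally show "(\<integral>v. heat \<alpha> v k \<partial>?q) \<le> \<delta> * x\<^sup>2 * (\<Sum>l. \<alpha> (Suc l))" .
  have "(\<integral>v. of_bool (v k = x) * heat \<alpha> v k \<partial>?q)
      = (\<integral>v. (\<Sum>l\<in>{1..<k}. \<alpha> (k - l) * (of_bool (v k = x) * (v l)\<^sup>2)) \<partial>?q)"
    unfolding heat_def by (simp add: sum_distrib_left mult_ac)
  also have "\<dots> = (\<Sum>l\<in>{1..<k}. \<alpha> (k - l) * (\<integral>v. of_bool (v k = x) * (v l)\<^sup>2 \<partial>?q))"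
    by (subst Bochner_Integration.integral_sum) (auto intro: int)
  also have "\<dots> = (\<Sum>l\<in>{1..<k}. \<alpha> (k - l) * (\<delta> * (\<delta> * x\<^sup>2)))"
    using k \<delta> \<open>x \<noteq> 0\<close>
    by (intro sum.cong refl)
       (auto simp: integral_on_off_block_pair[where f = "\<lambda>v. of_bool (v = x)" and g = "\<lambda>v. v\<^sup>2"])
  also have "\<dots> = \<delta> * (\<delta> * x\<^sup>2 * (\<Sum>l\<in>{1..<k}. \<alpha> (k - l)))" by (simp add: sum_distrib_left mult_ac)
  also have "\<dots> \<le> \<delta> * (\<delta> * x\<^sup>2 * (\<Sum>l. \<alpha> (Suc l)))" using \<delta> by (intro mult_left_mono sum) auto
  finally show "(\<integral>v. of_bool (v k = x) * heat \<alpha> v k \<partial>?q) \<le> \<delta> * (\<delta> * x\<^sup>2 * (\<Sum>l. \<alpha> (Suc l)))" .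
qed

section \<open>From the score to the information rate\<close>

text \<open>Here \<open>s\<close> is the noise scale after heating and \<open>\<epsilon>\<close> the
  error it causes in the two expectations. A pulse earns about \<open>a\<close> and a silent symbol
  loses about \<open>\<delta> * (b - 1)\<close>. A single expression covers both, so that it can be
  averaged over the input.\<close>

lemma expected_score_ge:
  fixes \<nu> :: "real measure" and g :: "real \<Rightarrow> real"
  assumes \<nu>: "prob_space \<nu>" "sets \<nu> = sets borel"
    and [measurable]: "g \<in> borel_measurable borel" and B: "\<And>y. \<bar>g y\<bar> \<le> B"
    and \<delta>: "0 < \<delta>" "\<delta> < 1" and "x \<noteq> 0" and c: "c = x \<or> c = 0"
    and hit: "(\<integral>u. g (x + s * u) \<partial>\<nu>) \<ge> a - \<epsilon>"
    and idle: "(\<integral>u. exp (g (s * u)) \<partial>\<nu>) \<le> b + \<epsilon>" and "b \<ge> 0" "\<epsilon> \<ge> 0"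
  shows "of_bool (c = x) * (a - \<epsilon> - \<delta> * exp B) - \<delta> * (b - 1 + \<epsilon>)
    \<le> (\<integral>u. on_off_score g \<delta> x c (c + s * u) \<partial>\<nu>)"
proof -
  interpret prob_space \<nu> by fact
  note [measurable_cong] = \<nu>(2)
  have int_g: "integrable \<nu> (\<lambda>u. g (c + s * u))"
    by (rule integrable_bounded[of _ B]) (use B in auto)
  have int_e: "integrable \<nu> (\<lambda>u. exp (g (c + s * u)))" and e_le: "(\<integral>u. exp (g (c + s * u)) \<partial>\<nu>) \<le> exp B"
    using B by (auto intro!: expectation_exp_bounds(1,3)[of "\<lambda>u. g (c + s * u)" B])
  have int_s: "integrable \<nu> (\<lambda>u. on_off_score g \<delta> x c (c + s * u))"
  proof (rule integrable_bounded)
    show "(\<lambda>u. on_off_score g \<delta> x c (c + s * u)) \<in> borel_measurable \<nu>"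
      by measurable
    show "\<bar>on_off_score g \<delta> x c (c + s * u)\<bar> \<le> 2 * B" for u
      by (intro on_off_score_bound \<delta> B)
  qed
  have int_if: "integrable \<nu> (\<lambda>u. (if c = x then g (c + s * u) else 0))"
    using int_g by (cases "c = x") auto
  have "(\<integral>u. (if c = x then g (c + s * u) else 0) - \<delta> * (exp (g (c + s * u)) - 1) \<partial>\<nu>)
      \<le> (\<integral>u. on_off_score g \<delta> x c (c + s * u) \<partial>\<nu>)"
    by (intro integral_mono int_s on_off_score_ge \<delta> Bochner_Integration.integrable_diff integrable_mult_right int_if int_e) auto
  moreover have "(\<integral>u. (if c = x then g (c + s * u) else 0) - \<delta> * (exp (g (c + s * u)) - 1) \<partial>\<nu>)
      = (\<integral>u. (if c = x then g (c + s * u) else 0) \<partial>\<nu>) - \<delta> * ((\<integral>u. exp (g (c + s * u)) \<partial>\<nu>) - 1)"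
    using int_if int_e prob_space by (simp add: Bochner_Integration.integral_diff)
  moreover have "of_bool (c = x) * (a - \<epsilon> - \<delta> * exp B) - \<delta> * (b - 1 + \<epsilon>)
    \<le> (\<integral>u. (if c = x then g (c + s * u) else 0) \<partial>\<nu>) - \<delta> * ((\<integral>u. exp (g (c + s * u)) \<partial>\<nu>) - 1)"
  proof (cases "c = x")
    case True
    \<comment> \<open>For a pulse the exponential moment is bounded crudely by \<open>exp B\<close>.
      Charging the loss of a silent symbol as well only lowers the left-hand side, up to the
      \<open>\<delta>\<close> that both sides share.\<close>
    have "0 \<le> \<delta> * (b + \<epsilon>)" using \<delta> assms(11,12) by simp
    moreover have "\<delta> * (\<integral>u. exp (g (c + s * u)) \<partial>\<nu>) \<le> \<delta> * exp B"
      using \<delta> e_le by (intro mult_left_mono) auto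
    ultimately show ?thesis using hit True by (simp add: algebra_simps)
  next
    case False
    then have "c = 0" using c by simp
    moreover have "\<delta> * (\<integral>u. exp (g (s * u)) \<partial>\<nu>) \<le> \<delta> * (b + \<epsilon>)"
      using \<delta> idle by (intro mult_left_mono) auto
    ultimately show ?thesis using False by (simp add: algebra_simps)
  qed
  ultimately show ?thesis by linarith
qed

text \<open>Given the input sequence, the heat at each time is a fixed number \<open>t\<close>, so
  \<open>hit\<close> and \<open>idle\<close> apply coordinate by coordinate. Averaging over the
  input then yields two heat terms, one from pulses and one from the normalization, each at most
  \<open>\<kappa>\<close> times \<open>\<delta>\<^sup>2 * x\<^sup>2\<close> times the coefficient
  sum.\<close>

lemma on_off_information_ge:
  fixes U :: "int \<Rightarrow> 'a \<Rightarrow> real"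
  assumes M: "prob_space M" and U [measurable]: "\<And>k. U k \<in> borel_measurable M"
    and \<nu>: "\<And>k. distr M borel (U k) = \<nu>"
    and \<alpha>: "\<And>l. l \<ge> 1 \<Longrightarrow> \<alpha> l \<ge> 0" "summable (\<lambda>l. \<alpha> (Suc l))"
    and g [measurable]: "g \<in> borel_measurable borel" and B: "\<And>y. \<bar>g y\<bar> \<le> B"
    and \<delta>: "0 < \<delta>" "\<delta> < 1" and "x \<noteq> 0" and "b \<ge> 0" "\<eta> \<ge> 0" "\<kappa> \<ge> 0"
    and hit: "\<And>t. t \<ge> 0 \<Longrightarrow> (\<integral>u. g (x + sqrt (\<sigma>\<^sup>2 + t) * u) \<partial>\<nu>) \<ge> a - (\<eta> + \<kappa> * t)"
    and idle: "\<And>t. t \<ge> 0 \<Longrightarrow> (\<integral>u. exp (g (sqrt (\<sigma>\<^sup>2 + t) * u)) \<partial>\<nu>) \<le> b + (\<eta> + \<kappa> * t)"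
  shows "real n * (\<delta> * (a - b + 1 - 2 * \<eta> - \<delta> * (exp B + 2 * \<kappa> * x\<^sup>2 * (\<Sum>l. \<alpha> (Suc l)))))
    \<le> io_information \<sigma> \<alpha> M U n
      (distr (on_off_block n \<delta> x) (block_space n) (\<lambda>v. restrict v {1..n}))"
proof -
  interpret prob_space M by fact
  have prob_\<nu>: "prob_space \<nu>" and sets_\<nu> [measurable_cong]: "sets \<nu> = sets borel"
    using \<nu>[of 0] by (auto intro!: prob_space_distr)
  let ?q = "on_off_block n \<delta> x"
  let ?e = "\<lambda>v. restrict v {1..n} :: nat \<Rightarrow> real"
  let ?A = "\<Sum>l. \<alpha> (Suc l)"
  let ?s = "\<lambda>v k. sqrt (\<sigma>\<^sup>2 + heat \<alpha> v k)"
  define G :: "(nat \<Rightarrow> real) \<times> (nat \<Rightarrow> real) \<Rightarrow> real"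
    where "G p = (\<Sum>k\<in>{1..n}. on_off_score g \<delta> x (fst p k) (snd p k))" for p
  have e: "?e \<in> measurable (measure_pmf ?q) (block_space n)" by (auto simp: space_PiM)
  have G_meas: "G \<in> borel_measurable (block_space n \<Otimes>\<^sub>M block_space n)"
    unfolding G_def
    by (intro borel_measurable_sum measurable_on_off_score g measurable_compose[OF measurable_fst measurable_component_singleton]
          measurable_compose[OF measurable_snd measurable_component_singleton])
  have G_le: "\<bar>G p\<bar> \<le> (\<Sum>k\<in>{1..n}. 2 * B)" for p
    unfolding G_def by (rule order_trans[OF sum_abs sum_mono]) (intro on_off_score_bound \<delta> B)
  have G_exp: "(\<integral>v. exp (G (?e v, y)) \<partial>?q) \<le> 1" for y
  proof -
    have "(\<integral>v. exp (G (?e v, y)) \<partial>?q) = (\<integral>v. (\<Prod>k\<in>{1..n}. exp (on_off_score g \<delta> x (v k) (y k))) \<partial>?q)"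
      by (simp add: G_def exp_sum)
    also have "\<dots> = (\<Prod>k\<in>{1..n}. \<integral>c. exp (on_off_score g \<delta> x c (y k)) \<partial>on_off_pmf \<delta> x)"
      unfolding on_off_block_def by (intro expectation_prod_Pi_pmf) (auto intro: integrable_measure_pmf_finite)
    also have "\<dots> = 1" using \<delta> \<open>x \<noteq> 0\<close> by (simp add: integral_exp_on_off_score)
    finally show ?thesis by simp
  qed
  have int: "integrable ?q f" for f :: "_ \<Rightarrow> real"
    by (rule integrable_measure_pmf_finite) simp
  \<comment> \<open>The bound of \<open>expected_score_ge\<close> with error
    \<open>\<eta> + \<kappa> * heat \<alpha> v k\<close>, expanded so that the heat occurs exactly
    in the two forms whose means are bounded by \<open>expected_heat_le\<close>.\<close>
  let ?L = "\<lambda>v k. of_bool (v k = x) * (a - \<eta> - \<delta> * exp B) - \<delta> * (b - 1 + \<eta>)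
      - \<kappa> * (of_bool (v k = x) * heat \<alpha> v k) - \<delta> * \<kappa> * heat \<alpha> v k"
  have inner: "(\<Sum>k\<in>{1..n}. ?L v k) \<le> (\<integral>\<omega>. G (?e v, output_block \<sigma> \<alpha> U n (?e v) \<omega>) \<partial>M)"
    if v: "v \<in> set_pmf ?q" for v
  proof -
    have out: "output_block \<sigma> \<alpha> U n (?e v) \<omega> k = v k + ?s v k * U (int k) \<omega>" if "k \<in> {1..n}" for k \<omega>
    proof -
      have "(\<Sum>l\<in>{1..<k}. \<alpha> (k - l) * (?e v l)\<^sup>2) = heat \<alpha> v k"
        unfolding heat_def using that by (intro sum.cong) auto
      then show ?thesis using that by (simp add: output_block_def channel_output_def)
    qed
    have "(\<integral>\<omega>. G (?e v, output_block \<sigma> \<alpha> U n (?e v) \<omega>) \<partial>M)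
        = (\<integral>\<omega>. (\<Sum>k\<in>{1..n}. on_off_score g \<delta> x (v k) (v k + ?s v k * U (int k) \<omega>)) \<partial>M)"
      unfolding G_def by (intro Bochner_Integration.integral_cong sum.cong) (simp_all only: out restrict_apply' fst_conv snd_conv)
    also have "\<dots> = (\<Sum>k\<in>{1..n}. \<integral>\<omega>. on_off_score g \<delta> x (v k) (v k + ?s v k * U (int k) \<omega>) \<partial>M)"
    proof (rule Bochner_Integration.integral_sum)
      fix k show "integrable M (\<lambda>\<omega>. on_off_score g \<delta> x (v k) (v k + ?s v k * U (int k) \<omega>))"
        by (rule integrable_bounded[of _ "2 * B"]) (measurable, intro on_off_score_bound \<delta> B)
    qed
    finally have eq: "(\<integral>\<omega>. G (?e v, output_block \<sigma> \<alpha> U n (?e v) \<omega>) \<partial>M) = \<dots>" .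
    show ?thesis
      unfolding eq
    proof (rule sum_mono)
      fix k
      have t: "0 \<le> heat \<alpha> v k" by (rule heat_nonneg[OF \<alpha>(1)])
      have "?L v k = of_bool (v k = x) * (a - (\<eta> + \<kappa> * heat \<alpha> v k) - \<delta> * exp B) - \<delta> * (b - 1 + (\<eta> + \<kappa> * heat \<alpha> v k))"
        by (simp add: algebra_simps)
      also have "\<dots> \<le> (\<integral>u. on_off_score g \<delta> x (v k) (v k + ?s v k * u) \<partial>\<nu>)"
        using \<open>b \<ge> 0\<close> \<open>\<eta> \<ge> 0\<close> \<open>\<kappa> \<ge> 0\<close> t
        by (intro expected_score_ge prob_\<nu> sets_\<nu> g B \<delta> \<open>x \<noteq> 0\<close> on_off_block_values[OF v] hit idle) auto
      also have "\<dots> = (\<integral>\<omega>. on_off_score g \<delta> x (v k) (v k + ?s v k * U (int k) \<omega>) \<partial>M)"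
        unfolding \<nu>[of "int k", symmetric] by (rule integral_distr) measurable
      finally show "?L v k \<le> \<dots>" .
    qed
  qed
  have "real n * (\<delta> * (a - b + 1 - 2 * \<eta> - \<delta> * (exp B + 2 * \<kappa> * x\<^sup>2 * ?A)))
      = (\<Sum>k\<in>{1..n}. \<delta> * (a - \<eta> - \<delta> * exp B) - \<delta> * (b - 1 + \<eta>)
        - \<kappa> * (\<delta> * (\<delta> * x\<^sup>2 * ?A)) - \<delta> * \<kappa> * (\<delta> * x\<^sup>2 * ?A))"
    by (simp add: algebra_simps)
  also have "\<dots> \<le> (\<Sum>k\<in>{1..n}. (\<integral>v. of_bool (v k = x) \<partial>?q) * (a - \<eta> - \<delta> * exp B) - \<delta> * (b - 1 + \<eta>)
        - \<kappa> * (\<integral>v. of_bool (v k = x) * heat \<alpha> v k \<partial>?q) - \<delta> * \<kappa> * (\<integral>v. heat \<alpha> v k \<partial>?q))"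
  proof (rule sum_mono)
    fix k assume k: "k \<in> {1..n}"
    have mean: "(\<integral>v. of_bool (v k = x) \<partial>?q) = \<delta>"
      using k \<delta> \<open>x \<noteq> 0\<close> by (simp add: integral_on_off_block_component[where f = "\<lambda>c. of_bool (c = x)"])
    have "\<kappa> * (\<integral>v. of_bool (v k = x) * heat \<alpha> v k \<partial>?q) \<le> \<kappa> * (\<delta> * (\<delta> * x\<^sup>2 * ?A))"
      using \<delta> \<open>\<kappa> \<ge> 0\<close> k \<open>x \<noteq> 0\<close> by (intro mult_left_mono expected_heat_le \<alpha>) auto
    moreover have "\<delta> * \<kappa> * (\<integral>v. heat \<alpha> v k \<partial>?q) \<le> \<delta> * \<kappa> * (\<delta> * x\<^sup>2 * ?A)"
      using \<delta> \<open>\<kappa> \<ge> 0\<close> k \<open>x \<noteq> 0\<close> by (intro mult_left_mono expected_heat_le \<alpha>) auto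
    ultimately show "\<delta> * (a - \<eta> - \<delta> * exp B) - \<delta> * (b - 1 + \<eta>)
        - \<kappa> * (\<delta> * (\<delta> * x\<^sup>2 * ?A)) - \<delta> * \<kappa> * (\<delta> * x\<^sup>2 * ?A)
      \<le> (\<integral>v. of_bool (v k = x) \<partial>?q) * (a - \<eta> - \<delta> * exp B) - \<delta> * (b - 1 + \<eta>)
        - \<kappa> * (\<integral>v. of_bool (v k = x) * heat \<alpha> v k \<partial>?q) - \<delta> * \<kappa> * (\<integral>v. heat \<alpha> v k \<partial>?q)"
      unfolding mean by linarith
  qed
  also have "\<dots> = (\<Sum>k\<in>{1..n}. \<integral>v. ?L v k \<partial>?q)"
    by (simp add: int Bochner_Integration.integral_diff)
  also have "\<dots> = (\<integral>v. (\<Sum>k\<in>{1..n}. ?L v k) \<partial>?q)"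
    by (rule Bochner_Integration.integral_sum[symmetric]) (rule int)
  also have "\<dots> \<le> (\<integral>v. (\<integral>\<omega>. G (?e v, output_block \<sigma> \<alpha> U n (?e v) \<omega>) \<partial>M) \<partial>?q)"
    by (intro integral_mono_AE int AE_pmfI inner)
  also have "\<dots> \<le> io_information \<sigma> \<alpha> M U n (distr ?q (block_space n) ?e)"
    unfolding io_information_def
    by (rule mutual_information_ge[OF M _ e measurable_output_block_pair[OF U] G_meas G_le G_exp]) simp
  finally show ?thesis .
qed

text \<open>Pulses of height \<open>x\<close> with frequency \<open>\<delta>\<close> use an SNR of
  \<open>\<delta> * x\<^sup>2 / \<sigma>\<^sup>2\<close>. Dividing the information rate by it
  cancels \<open>\<delta>\<close> and leaves the variational value up to terms that are small with
  \<open>\<delta>\<close> and \<open>\<eta>\<close>.\<close>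

lemma info_capacity_per_snr_ge:
  fixes U :: "int \<Rightarrow> 'a \<Rightarrow> real"
  assumes M: "prob_space M" and U [measurable]: "\<And>k. U k \<in> borel_measurable M"
    and \<nu>: "\<And>k. distr M borel (U k) = \<nu>" and "\<sigma> > 0"
    and \<alpha>: "\<And>l. l \<ge> 1 \<Longrightarrow> \<alpha> l \<ge> 0" "summable (\<lambda>l. \<alpha> (Suc l))"
    and g: "continuous_on UNIV g" and B: "\<And>y. \<bar>g y\<bar> \<le> B" and "x \<noteq> 0"
  defines "V \<equiv> (\<integral>u. g (x + \<sigma> * u) \<partial>\<nu>) - (\<integral>u. exp (g (\<sigma> * u)) \<partial>\<nu>) + 1"
  shows "ereal (\<sigma>\<^sup>2 * V / x\<^sup>2) \<le> (SUP snr\<in>{0<..}. info_capacity \<sigma> \<alpha> M U snr / ereal snr)"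
proof (rule ereal_le_epsilon2)
  fix \<epsilon> :: real assume "\<epsilon> > 0"
  interpret prob_space M by fact
  have prob_\<nu>: "prob_space \<nu>" and sets_\<nu>: "sets \<nu> = sets borel"
    using \<nu>[of 0] by (auto intro!: prob_space_distr)
  \<comment> \<open>The loss is \<open>3 * \<eta>\<close>: one \<open>\<eta>\<close> for each of the
    two perturbed expectations and one for \<open>\<delta> * D\<close>. Scaled by
    \<open>\<sigma>\<^sup>2 / x\<^sup>2\<close> it is exactly \<open>\<epsilon>\<close>.\<close>
  define \<eta> where "\<eta> = \<epsilon> * x\<^sup>2 / \<sigma>\<^sup>2 / 3"
  have "\<eta> > 0" using \<open>\<epsilon> > 0\<close> \<open>\<sigma> > 0\<close> \<open>x \<noteq> 0\<close> by (simp add: \<eta>_def)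
  have gm: "g \<in> borel_measurable borel" by (rule borel_measurable_continuous_onI[OF g])
  obtain \<kappa>1 where \<kappa>1: "\<kappa>1 \<ge> 0"
    "\<And>t. t \<ge> 0 \<Longrightarrow> \<bar>(\<integral>u. g (x + sqrt (\<sigma>\<^sup>2 + t) * u) \<partial>\<nu>) - (\<integral>u. g (x + \<bar>\<sigma>\<bar> * u) \<partial>\<nu>)\<bar> \<le> \<eta> + \<kappa>1 * t"
    using expectation_scaling_perturbation[OF prob_\<nu> sets_\<nu> g B \<open>\<eta> > 0\<close>, where \<sigma> = \<sigma> and a = x] by blast
  have exp_g: "continuous_on UNIV (\<lambda>y. exp (g y))" by (intro continuous_intros g)
  have exp_B: "\<bar>exp (g y)\<bar> \<le> exp B" for y using B[of y] by simp
  obtain \<kappa>2 where \<kappa>2: "\<kappa>2 \<ge> 0"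
    "\<And>t. t \<ge> 0 \<Longrightarrow> \<bar>(\<integral>u. exp (g (0 + sqrt (\<sigma>\<^sup>2 + t) * u)) \<partial>\<nu>) - (\<integral>u. exp (g (0 + \<bar>\<sigma>\<bar> * u)) \<partial>\<nu>)\<bar> \<le> \<eta> + \<kappa>2 * t"
    using expectation_scaling_perturbation[OF prob_\<nu> sets_\<nu> exp_g exp_B \<open>\<eta> > 0\<close>, where \<sigma> = \<sigma> and a = 0] by blast
  define \<kappa> where "\<kappa> = \<kappa>1 + \<kappa>2"
  define D where "D = exp B + 2 * \<kappa> * x\<^sup>2 * (\<Sum>l. \<alpha> (Suc l))"
  have "0 \<le> (\<Sum>l. \<alpha> (Suc l))" using \<alpha> by (intro suminf_nonneg) auto
  then have "D > 0" using \<kappa>1 \<kappa>2 by (auto simp: D_def \<kappa>_def intro!: add_pos_nonneg)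
  \<comment> \<open>The cap \<open>1 / 2\<close> keeps this a probability below 1; the other bound
    makes the second-order loss \<open>\<delta> * D\<close> at most \<open>\<eta>\<close>.\<close>
  define \<delta> where "\<delta> = min (1 / 2) (\<eta> / D)"
  have \<delta>: "0 < \<delta>" "\<delta> < 1" using \<open>\<eta> > 0\<close> \<open>D > 0\<close> by (auto simp: \<delta>_def)
  have \<delta>_D: "\<delta> * D \<le> \<eta>"
  proof -
    have "\<delta> * D \<le> \<eta> / D * D" using \<open>D > 0\<close> by (intro mult_right_mono) (auto simp: \<delta>_def)
    then show ?thesis using \<open>D > 0\<close> by simp
  qed
  let ?\<mu> = "\<lambda>n. distr (on_off_block n \<delta> x) (block_space n) (\<lambda>v. restrict v {1..n})"
  have info: "real n * (\<delta> * (V - 3 * \<eta>)) \<le> io_information \<sigma> \<alpha> M U n (?\<mu> n)" for n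
  proof -
    let ?a = "\<integral>u. g (x + \<sigma> * u) \<partial>\<nu>" and ?b = "\<integral>u. exp (g (\<sigma> * u)) \<partial>\<nu>"
    have "real n * (\<delta> * (V - 3 * \<eta>)) \<le> n * (\<delta> * (?a - ?b + 1 - 2 * \<eta> - \<delta> * D))"
      using \<delta> \<delta>_D by (intro mult_left_mono) (auto simp: V_def)
    also have "\<dots> \<le> io_information \<sigma> \<alpha> M U n (?\<mu> n)"
      unfolding D_def
    proof (rule on_off_information_ge[OF M U \<nu> \<alpha> gm B \<delta> \<open>x \<noteq> 0\<close>])
      fix t :: real assume "t \<ge> 0"
      then have "\<kappa>1 * t \<le> \<kappa> * t" "\<kappa>2 * t \<le> \<kappa> * t"
        using \<kappa>1(1) \<kappa>2(1) by (auto simp: \<kappa>_def intro!: mult_right_mono)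
      then show "?a - (\<eta> + \<kappa> * t) \<le> (\<integral>u. g (x + sqrt (\<sigma>\<^sup>2 + t) * u) \<partial>\<nu>)"
        "(\<integral>u. exp (g (sqrt (\<sigma>\<^sup>2 + t) * u)) \<partial>\<nu>) \<le> ?b + (\<eta> + \<kappa> * t)"
        using \<kappa>1(2)[OF \<open>t \<ge> 0\<close>] \<kappa>2(2)[OF \<open>t \<ge> 0\<close>] \<open>\<sigma> > 0\<close> by auto
    qed (use \<open>\<eta> > 0\<close> \<kappa>1(1) \<kappa>2(1) in \<open>auto simp: \<kappa>_def\<close>)
    finally show ?thesis .
  qed
  define snr where "snr = \<delta> * x\<^sup>2 / \<sigma>\<^sup>2"
  have snr: "snr > 0" "snr * \<sigma>\<^sup>2 = \<delta> * x\<^sup>2" using \<delta> \<open>\<sigma> > 0\<close> \<open>x \<noteq> 0\<close> by (auto simp: snr_def)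
  have "ereal (\<delta> * (V - 3 * \<eta>)) \<le> info_capacity \<sigma> \<alpha> M U snr"
    unfolding info_capacity_def
  proof (rule Liminf_bounded)
    show "\<forall>\<^sub>F n in sequentially. ereal (\<delta> * (V - 3 * \<eta>))
      \<le> (SUP \<mu>\<in>input_laws n (snr * \<sigma>\<^sup>2). ereal (io_information \<sigma> \<alpha> M U n \<mu>)) / ereal (real n)"
      using eventually_ge_at_top[of 1]
    proof eventually_elim
      case (elim n)
      have "ereal (real n * (\<delta> * (V - 3 * \<eta>))) \<le> ereal (io_information \<sigma> \<alpha> M U n (?\<mu> n))"
        using info[of n] by simp
      also have "\<dots> \<le> (SUP \<mu>\<in>input_laws n (snr * \<sigma>\<^sup>2). ereal (io_information \<sigma> \<alpha> M U n \<mu>))"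
        unfolding snr(2) using \<delta> elim by (intro SUP_upper on_off_block_input_law) auto
      finally show ?case using elim by (simp add: ereal_le_divide_pos)
    qed
  qed
  then have "ereal (\<delta> * (V - 3 * \<eta>) / snr) \<le> info_capacity \<sigma> \<alpha> M U snr / ereal snr"
    using snr(1) ereal_divide_right_mono[of "ereal (\<delta> * (V - 3 * \<eta>))" _ "ereal snr"] by simp
  also have "\<delta> * (V - 3 * \<eta>) / snr = \<sigma>\<^sup>2 * V / x\<^sup>2 - \<epsilon>"
    using \<delta> \<open>\<sigma> > 0\<close> \<open>x \<noteq> 0\<close> by (simp add: snr_def \<eta>_def field_simps)
  also have "info_capacity \<sigma> \<alpha> M U snr / ereal snr \<le> (SUP snr\<in>{0<..}. info_capacity \<sigma> \<alpha> M U snr / ereal snr)"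
    using snr(1) by (intro SUP_upper) auto
  finally have "ereal (\<sigma>\<^sup>2 * V / x\<^sup>2 - \<epsilon>) + ereal \<epsilon> \<le> (SUP snr\<in>{0<..}. info_capacity \<sigma> \<alpha> M U snr / ereal snr) + ereal \<epsilon>"
    by (rule add_right_mono)
  then show "ereal (\<sigma>\<^sup>2 * V / x\<^sup>2) \<le> (SUP snr\<in>{0<..}. info_capacity \<sigma> \<alpha> M U snr / ereal snr) + ereal \<epsilon>"
    by simp
qed

subsection \<open>Capacity per unit cost\<close>

theorem proposition1:
  fixes M :: "'a measure" and U :: "int \<Rightarrow> 'a \<Rightarrow> real"
    and \<sigma> :: real and \<alpha> :: "nat \<Rightarrow> real"
  assumes "\<sigma> > 0"
    and "\<And>l. l \<ge> 1 \<Longrightarrow> \<alpha> l \<ge> 0"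
    and "bdd_above (\<alpha> ` {1..})"
    and "prob_space M"
    and "\<And>k. U k \<in> borel_measurable M"
    and "\<And>k. prob_space.expectation M (U k) = 0"
    and "\<And>k. prob_space.variance M (U k) = 1"
    and "\<And>k. integrable M (\<lambda>\<omega>. U k \<omega> ^ 4)"
    and "stationary_process M U"
    and "weakly_mixing_process M U"
    and "\<And>k. diff_entropy_given_past M U k > - \<infinity>"
    and summable: "summable (\<lambda>l. \<alpha> (Suc l))"
    and iid_indep: "prob_space.indep_vars M (\<lambda>_. borel) U UNIV"
    and iid_ident: "\<And>j k. distr M borel (U j) = distr M borel (U k)"
  shows "(SUP snr\<in>{0<..}. info_capacity \<sigma> \<alpha> M U snr / ereal snr) \<ge>
         (SUP snr\<in>{0<..}. capacity \<sigma> (\<lambda>_. 0) M U snr / ereal snr)"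
proof -
  interpret prob_space M by fact
  note U [measurable] = assms(5)
  let ?\<nu> = "distr M borel (U 0)"
  define L where "L = (SUP snr\<in>{0<..}. info_capacity \<sigma> \<alpha> M U snr / ereal snr)"
  have low: "ereal (\<sigma>\<^sup>2 * ((\<integral>u. g (x + \<sigma> * u) \<partial>?\<nu>) - (\<integral>u. exp (g (\<sigma> * u)) \<partial>?\<nu>) + 1) / x\<^sup>2) \<le> L"
    if "continuous_on UNIV g" "\<And>y. \<bar>g y\<bar> \<le> B" "x \<noteq> 0" for g :: "real \<Rightarrow> real" and B x
    unfolding L_def
    by (rule info_capacity_per_snr_ge[OF assms(4) U iid_ident assms(1,2) summable that])
  show ?thesis
    unfolding L_def[symmetric]
  proof (cases "L = \<infinity>")
    case False
    \<comment> \<open>The zero test function has variational value 0, which excludes negative values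
      and minus infinity for \<open>L\<close>. The converse takes a nonnegative real slope
      \<open>K\<close>.\<close>
    have "ereal (\<sigma>\<^sup>2 * ((\<integral>u. 0 \<partial>?\<nu>) - (\<integral>u. exp 0 \<partial>?\<nu>) + 1) / 1\<^sup>2) \<le> L"
      by (rule low[of "\<lambda>_. 0" 0 1]) auto
    moreover have "measure ?\<nu> (space ?\<nu>) = 1"
      by (intro prob_space.prob_space prob_space_distr) simp
    ultimately have "0 \<le> L" by (simp add: zero_ereal_def)
    with False obtain K where K: "L = ereal K" "K \<ge> 0" by (cases L) auto
    \<comment> \<open>Link between the two halves: as \<open>K\<close> bounds every variational
      value per unit cost, a codeword letter \<open>a\<close> has relative entropy at most
      \<open>K / \<sigma>\<^sup>2 * a\<^sup>2\<close> to the zero letter, which is what the converse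
      assumes.\<close>
    have D: "relative_entropy_le (distr M borel (\<lambda>\<omega>. a + \<sigma> * U k \<omega>)) (distr M borel (\<lambda>\<omega>. \<sigma> * U k \<omega>)) (K / \<sigma>\<^sup>2 * a\<^sup>2)" for k a
    proof (rule relative_entropy_le_lborelI)
      have ac: "absolutely_continuous lborel (distr M borel (\<lambda>\<omega>. c + \<sigma> * U k \<omega>))" for c
        using assms(1) by (intro absolutely_continuous_affine law_absolutely_continuous[OF assms(4) U assms(11)]) auto
      show "absolutely_continuous lborel (distr M borel (\<lambda>\<omega>. a + \<sigma> * U k \<omega>))" by (rule ac)
      show "absolutely_continuous lborel (distr M borel (\<lambda>\<omega>. \<sigma> * U k \<omega>))" using ac[of 0] by simp
      show "prob_space (distr M borel (\<lambda>\<omega>. a + \<sigma> * U k \<omega>))" "prob_space (distr M borel (\<lambda>\<omega>. \<sigma> * U k \<omega>))"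
        by (intro prob_space_distr; measurable)+
      fix g :: "real \<Rightarrow> real" and B
      assume g: "continuous_on UNIV g" and B: "\<And>y. \<bar>g y\<bar> \<le> B"
      have [measurable]: "g \<in> borel_measurable borel" by (rule borel_measurable_continuous_onI[OF g])
      let ?V = "(\<integral>u. g (a + \<sigma> * u) \<partial>?\<nu>) - (\<integral>u. exp (g (\<sigma> * u)) \<partial>?\<nu>) + 1"
      have "(\<integral>y. g y \<partial>distr M borel (\<lambda>\<omega>. a + \<sigma> * U k \<omega>)) - (\<integral>y. exp (g y) \<partial>distr M borel (\<lambda>\<omega>. \<sigma> * U k \<omega>)) + 1 = ?V"
        unfolding iid_ident[of 0 k] by (simp add: integral_distr)
      also have "?V \<le> K / \<sigma>\<^sup>2 * a\<^sup>2"
      \<comment> \<open>\<open>low\<close> divides by the squared pulse height. At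
        \<open>a = 0\<close> the two laws coincide, and \<open>1 + t \<le> exp t\<close> gives the
        bound directly.\<close>
      proof (cases "a = 0")
        case True
        interpret \<nu>: prob_space ?\<nu> by (rule prob_space_distr) simp
        have int: "integrable ?\<nu> (\<lambda>u. g (\<sigma> * u))" "integrable ?\<nu> (\<lambda>u. exp (g (\<sigma> * u)))"
          using B by (auto intro!: \<nu>.integrable_bounded[of _ B] \<nu>.expectation_exp_bounds(1)[of _ B])
        have "(\<integral>u. g (\<sigma> * u) \<partial>?\<nu>) + 1 = (\<integral>u. g (\<sigma> * u) + 1 \<partial>?\<nu>)"
          using int \<nu>.prob_space by simp
        also have "\<dots> \<le> (\<integral>u. exp (g (\<sigma> * u)) \<partial>?\<nu>)"
          using int by (intro integral_mono) (auto simp: add.commute intro: exp_ge_add_one_self)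
        finally show ?thesis using True by simp
      next
        case False
        then have "\<sigma>\<^sup>2 * ?V / a\<^sup>2 \<le> K" using low[OF g B False] K(1) by simp
        then show ?thesis using False assms(1) by (simp add: field_simps)
      qed
      finally show "(\<integral>y. g y \<partial>distr M borel (\<lambda>\<omega>. a + \<sigma> * U k \<omega>)) - (\<integral>y. exp (g y) \<partial>distr M borel (\<lambda>\<omega>. \<sigma> * U k \<omega>)) + 1 \<le> K / \<sigma>\<^sup>2 * a\<^sup>2" .
    qed simp_all
    show "(SUP snr\<in>{0<..}. capacity \<sigma> (\<lambda>_. 0) M U snr / ereal snr) \<le> L"
    proof (rule SUP_least)
      fix snr :: real assume "snr \<in> {0<..}"
      then have snr: "snr > 0" by simp
      have "capacity \<sigma> (\<lambda>_. 0) M U snr \<le> ereal (K * snr)"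
        unfolding capacity_def
      proof (rule SUP_least)
        fix R assume "R \<in> {R. achievable \<sigma> (\<lambda>_. 0) M U (snr * \<sigma>\<^sup>2) R}"
        then have "R \<le> K / \<sigma>\<^sup>2 * (snr * \<sigma>\<^sup>2)"
          using K(2) by (intro achievable_rate_le[OF assms(4) U iid_indep assms(1) _ D]) auto
        then show "ereal R \<le> ereal (K * snr)" using assms(1) by simp
      qed
      then show "capacity \<sigma> (\<lambda>_. 0) M U snr / ereal snr \<le> L"
        using snr ereal_divide_right_mono[of "capacity \<sigma> (\<lambda>_. 0) M U snr" "ereal (K * snr)" "ereal snr"]
        by (simp add: K(1))
    qed
  qed simp
qed

end
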